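(* Let $(X,\|\cdot\|)$ be a Banach space and let $I\in C^1(X,\mathbb{R})$ be a functional of the form $I(u)=A(u)-B(u)$ for all $u\in X$, satisfying conditions (A) and ($\Psi$) stated in the context, with $\{\psi_n\}\subset C(X,X)$ the sequence of mappings in ($\Psi$). Assume $X=Y\oplus Z$ with $\dim Y<\infty$ and assume that there exist $\rho>r>0$ and $z\in Z$ with $\|z\|=r$ such that $$\inf_{u\in Z,\ \|u\|=r}I(u)>\max_{u\in M_0}I(u)\qquad\text{and}\qquad \lim_{n\to\infty}\max_{u\in M_0}\|\psi_n(u)-u\|=0,$$ where $M_0:=\{u\in Y:\|u\|\le\rho\}\cup\{u\in Y+\mathbb{R}_+z:\|u\|=\rho\}$. Define $$c:=\inf_{\gamma\in\Gamma}\max_{u\in\gamma(M)}I(u),\quad \Gamma:=\{\gamma\in C(M,X):\gamma_{|M_0}=\mathrm{id}\},\quad M:=\{u\in Y+\mathbb{R}_+^0z:\|u\|\le\rho\}.$$ Then there exists a sequence $\{w_n\}\subset X$ such that $$I(w_n)\to c,\qquad I'(w_n)\to 0\ \text{in } X',\qquad \sup_n A(w_n)<\infty.$$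
   Context: $\mathbb{R}_+:=(0,+\infty)$ and $\mathbb{R}_+^0:=[0,+\infty)$. $X'$ denotes the dual space of $X$, $C(S,T)$ is the set of continuous maps from $S$ to $T$, and $A,B:X\to\mathbb{R}$ are functions. $X=Y\oplus Z$ means a topological direct sum of closed linear subspaces. For $l\in\mathbb{R}$ put $A^{l}:=\{u\in X:A(u)\le l\}$, and $\mathrm{dist}(u,A^{l}):=\inf_{h\in A^{l}}\|u-h\|$. Condition (A): $A$ is nonnegative and for all $l_2>l_1>0$ there exists $\delta_{l_1,l_2}>0$ such that for all $u\in X$, $\mathrm{dist}(u,A^{l_1})\le\delta_{l_1,l_2}$ implies $u\in A^{l_2}$. Condition ($\Psi$): there exists a sequence of mappings $\{\psi_n\}\subset C(X,X)$ such that for every $n$ there exist $\alpha_n>\beta_n>0$ satisfying ($\Psi$1) $A(u)\ge\alpha_n A(\psi_n(u))$ and $B(u)\le\beta_n B(\psi_n(u))$ for all $u\in X$; ($\Psi$2) $\lim_{n\to\infty}\alpha_n=\lim_{n\to\infty}\beta_n=1$ and $\liminf_{n\to\infty}\dfrac{|1-\beta_n|}{\alpha_n-\beta_n}<\infty$. *)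

theory Defs
  imports "HOL-Analysis.Analysis"
begin

definition sublevel :: "('a \<Rightarrow> real) \<Rightarrow> real \<Rightarrow> 'a set" where
  "sublevel A l = {u. A u \<le> l}"

text \<open>Extended-real valued, so that the distance to the empty set is infinite
  (the library constant \<^const>\<open>infdist\<close> returns 0 there, and a sublevel set may be empty).\<close>

definition set_distance :: "'a::real_normed_vector \<Rightarrow> 'a set \<Rightarrow> ereal" where
  "set_distance u S = (INF h\<in>S. ereal (norm (u - h)))"

definition condition_A :: "('a::real_normed_vector \<Rightarrow> real) \<Rightarrow> bool" where
  "condition_A A \<longleftrightarrow>
     (\<forall>u. 0 \<le> A u) \<and>
     (\<forall>l1 l2. 0 < l1 \<and> l1 < l2 \<longrightarrow>
        (\<exists>\<delta>>0. \<forall>u. set_distance u (sublevel A l1) \<le> ereal \<delta> \<longrightarrow> u \<in> sublevel A l2))"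

definition condition_Psi ::
  "('a::real_normed_vector \<Rightarrow> real) \<Rightarrow> ('a \<Rightarrow> real) \<Rightarrow> (nat \<Rightarrow> 'a \<Rightarrow> 'a) \<Rightarrow> bool" where
  "condition_Psi A B \<psi> \<longleftrightarrow>
     (\<forall>n. continuous_on UNIV (\<psi> n)) \<and>
     (\<exists>\<alpha> \<beta> :: nat \<Rightarrow> real.
        (\<forall>n. \<alpha> n > \<beta> n \<and> \<beta> n > 0) \<and>
        (\<forall>n u. A u \<ge> \<alpha> n * A (\<psi> n u) \<and> B u \<le> \<beta> n * B (\<psi> n u)) \<and>
        \<alpha> \<longlonglongrightarrow> 1 \<and> \<beta> \<longlonglongrightarrow> 1 \<and>
        liminf (\<lambda>n. ereal (\<bar>1 - \<beta> n\<bar> / (\<alpha> n - \<beta> n))) < \<infinity>)"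

definition topological_direct_sum :: "'a::real_normed_vector set \<Rightarrow> 'a set \<Rightarrow> bool" where
  "topological_direct_sum Y Z \<longleftrightarrow>
     subspace Y \<and> closed Y \<and> subspace Z \<and> closed Z \<and>
     (\<exists>q. homeomorphism (Y \<times> Z) UNIV (\<lambda>(y, z). y + z) q)"

text \<open>The library's \<^const>\<open>dim\<close> is 0 on infinite-dimensional subspaces, so it cannot
  express finite-dimensionality.\<close>

definition finite_dimensional :: "'a::real_vector set \<Rightarrow> bool" where
  "finite_dimensional Y \<longleftrightarrow> (\<exists>E. finite E \<and> span E = Y)"

definition link_M :: "'a::real_normed_vector set \<Rightarrow> 'a \<Rightarrow> real \<Rightarrow> 'a set" where
  "link_M Y z \<rho> = {u. (\<exists>y\<in>Y. \<exists>t\<ge>0. u = y + t *\<^sub>R z) \<and> norm u \<le> \<rho>}"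

definition link_M0 :: "'a::real_normed_vector set \<Rightarrow> 'a \<Rightarrow> real \<Rightarrow> 'a set" where
  "link_M0 Y z \<rho> =
     {u \<in> Y. norm u \<le> \<rho>} \<union> {u. (\<exists>y\<in>Y. \<exists>t>0. u = y + t *\<^sub>R z) \<and> norm u = \<rho>}"

text \<open>Maps on \<^term>\<open>link_M Y z \<rho>\<close> are represented by total functions; values elsewhere are
  irrelevant.\<close>

definition link_Gamma :: "'a::real_normed_vector set \<Rightarrow> 'a \<Rightarrow> real \<Rightarrow> ('a \<Rightarrow> 'a) set" where
  "link_Gamma Y z \<rho> =
     {\<gamma>. continuous_on (link_M Y z \<rho>) \<gamma> \<and> (\<forall>u\<in>link_M0 Y z \<rho>. \<gamma> u = u)}"

text \<open>For finite-dimensional \<^term>\<open>Y\<close> and continuous \<^term>\<open>I\<close> the inner supremum is a maximum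
  of a continuous function over a nonempty compact set. The outer infimum is taken in the
  extended reals, so no lower bound is presupposed.\<close>

definition minimax_level ::
  "('a::real_normed_vector \<Rightarrow> real) \<Rightarrow> 'a set \<Rightarrow> 'a \<Rightarrow> real \<Rightarrow> ereal" where
  "minimax_level I Y z \<rho> =
     (INF \<gamma>\<in>link_Gamma Y z \<rho>. ereal (SUP u\<in>\<gamma> ` link_M Y z \<rho>. I u))"

end

theory Submission
  imports Defs "HOL-Homology.Brouwer_Degree"
begin

text \<open>
  Let \<open>c\<close> be the minimax level and \<open>m < c\<close> the maximum of \<open>I\<close> on the boundary \<open>M\<^sub>0\<close>. The linking
  geometry gives \<open>c > m\<close>: Brouwer's theorem shows that every admissible map meets the
  sphere of radius \<open>r\<close> in \<open>Z\<close> (\<open>linking_intersection\<close>).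

  The bound on \<open>A\<close> comes from (\<open>\<Psi>\<close>1), which yields
  \<open>\<beta> I (\<psi> u) + (\<alpha> - \<beta>) A (\<psi> u) \<le> I u\<close> with \<open>\<alpha> = \<alpha>\<^sub>n\<close>, \<open>\<beta> = \<beta>\<^sub>n\<close>, \<open>\<psi> = \<psi>\<^sub>n\<close>. Put
  \<open>\<epsilon> = \<alpha> - \<beta>\<close>, take an admissible \<open>\<gamma>\<close> with \<open>I \<circ> \<gamma> \<le> c + \<epsilon>\<close>, and consider \<open>g = \<psi> \<circ> \<gamma>\<close>. As
  \<open>A \<ge> 0\<close>, the inequality gives \<open>I \<circ> g \<le> (c + \<epsilon>) / \<beta>\<close>, which tends to \<open>c\<close>. Wherever
  \<open>I (g u) \<ge> c - \<epsilon>\<close>, it gives \<open>\<epsilon> A (g u) \<le> (1 - \<beta>) c + (1 + \<beta>) \<epsilon>\<close>, hence a bound on \<open>A (g u)\<close>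
  that is uniform along the indices for which \<open>\<bar>1 - \<beta>\<bar> / (\<alpha> - \<beta>)\<close> stays bounded; by (\<open>\<Psi>\<close>2) there
  are infinitely many of them.

  It remains to find, close to the high part of \<open>g\<close>, a point \<open>w\<close> with small derivative and with
  \<open>I w\<close> close to \<open>c\<close>; condition (A) then transfers the bound on \<open>A\<close> from \<open>g\<close> to \<open>w\<close>. To this end
  Ekeland's variational principle is applied to \<open>h \<mapsto> max I \<circ> h\<close> among the continuous maps \<open>h\<close> that
  agree with \<open>g\<close> on the low part \<open>{u. I (g u) \<le> c - \<epsilon>}\<close> (\<open>near_critical_point\<close>). This restriction
  ensures that maximum points of \<open>I \<circ> h\<close> lie in the high part of \<open>g\<close>.

  The principle requires \<open>max I \<circ> h \<ge> c\<close> for all these \<open>h\<close>, although they are not admissible: on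
  \<open>M\<^sub>0\<close>, which belongs to the low part, \<open>h\<close> equals \<open>\<psi>\<close> and not the identity. But \<open>\<psi>\<close> is
  uniformly close to the identity on \<open>M\<^sub>0\<close>, so \<open>h\<close> can be made admissible by a change that only
  creates values near \<open>M\<^sub>0\<close>, where \<open>I < c\<close> (\<open>boundary_correction\<close>).\<close>

section \<open>Finite-dimensional subspaces and Brouwer's theorem\<close>

lemma compact_box_nat:
  fixes R :: real
  shows "compact {x :: nat \<Rightarrow> real. (\<forall>i<m. \<bar>x i\<bar> \<le> R) \<and> (\<forall>i\<ge>m. x i = 0)}"
proof -
  let ?S = "\<lambda>i. if i < m then {-R..R} else {0::real}"
  have "compactin (product_topology (\<lambda>i::nat. euclidean) UNIV) (PiE UNIV ?S)"
    unfolding compactin_PiE by (auto simp: compactin_euclidean_iff)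
  then have "compact (PiE UNIV ?S)"
    by (simp add: euclidean_product_topology compactin_euclidean_iff)
  moreover have "PiE UNIV ?S = {x. (\<forall>i<m. \<bar>x i\<bar> \<le> R) \<and> (\<forall>i\<ge>m. x i = 0)}"
    by (auto simp: PiE_iff abs_le_iff split: if_splits) (force simp: not_less minus_le_iff)+
  ultimately show ?thesis by simp
qed

text \<open>Coordinates live in the product topology on \<open>nat \<Rightarrow> real\<close>, where only the first \<open>m\<close> entries
  matter. The dimension \<open>m\<close> is thus a number that comes out of a proof, not a type, and the unit
  sphere is \<^const>\<open>nsphere\<close>.\<close>

definition lincomb :: "nat \<Rightarrow> (nat \<Rightarrow> 'a::real_vector) \<Rightarrow> (nat \<Rightarrow> real) \<Rightarrow> 'a" where
  "lincomb m b x = (\<Sum>i<m. x i *\<^sub>R b i)"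

lemma lincomb_diff: "lincomb m b (\<lambda>i. x i - y i) = lincomb m b x - lincomb m b y"
  by (simp add: lincomb_def scaleR_left_diff_distrib sum_subtractf)

lemma lincomb_scale: "lincomb m b (\<lambda>i. c * x i) = c *\<^sub>R lincomb m b x"
  by (simp add: lincomb_def scaleR_sum_right)

lemma lincomb_cong: "(\<And>i. i < m \<Longrightarrow> x i = y i) \<Longrightarrow> lincomb m b x = lincomb m b y"
  by (simp add: lincomb_def)

lemma lincomb_zero: "(\<And>i. i < m \<Longrightarrow> x i = 0) \<Longrightarrow> lincomb m b x = 0"
  by (simp add: lincomb_def)

lemma continuous_on_lincomb:
  fixes b :: "nat \<Rightarrow> 'a::real_normed_vector"
  shows "continuous_on S (lincomb m b)"
  unfolding lincomb_def
  by (intro continuous_intros continuous_on_subset[OF continuous_on_product_coordinates]) auto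

text \<open>The norm of the combination attains a minimum on the compact Euclidean unit sphere of
  coefficient vectors, and by independence this minimum is positive; homogeneity does the rest.\<close>

lemma coefficient_bound:
  fixes b :: "nat \<Rightarrow> 'a::real_normed_vector"
  assumes inj: "\<And>x i. lincomb m b x = 0 \<Longrightarrow> i < m \<Longrightarrow> x i = (0::real)"
  obtains K where "K \<ge> 0" "\<And>x i. i < m \<Longrightarrow> \<bar>x i\<bar> \<le> K * norm (lincomb m b x)"
proof (cases "m = 0")
  case True
  then show ?thesis using that[of 0] by auto
next
  case False
  let ?\<phi> = "lincomb m b"
  let ?box = "{x :: nat \<Rightarrow> real. (\<forall>i<m. \<bar>x i\<bar> \<le> 1) \<and> (\<forall>i\<ge>m. x i = 0)}"
  let ?S = "?box \<inter> {x. (\<Sum>i<m. (x i)\<^sup>2) = 1}"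
  have "closed {x :: nat \<Rightarrow> real. (\<Sum>i<m. (x i)\<^sup>2) = 1}"
    by (intro closed_Collect_eq continuous_intros continuous_on_product_coordinates)
  then have cS: "compact ?S"
    by (intro compact_Int_closed compact_box_nat)
  have cont: "continuous_on ?S (\<lambda>x. norm (?\<phi> x))"
    by (intro continuous_on_norm continuous_on_lincomb)
  have ne: "(\<lambda>i. if i = 0 then 1 else 0) \<in> ?S"
  proof -
    have "(\<Sum>i<m. (if i = 0 then 1 else (0::real))\<^sup>2) = (\<Sum>i<m. if i = 0 then 1 else (0::real))"
      by (rule sum.cong) auto
    also have "\<dots> = 1" using False by simp
    finally show ?thesis using False by auto
  qed
  have "?S \<noteq> {}" using ne by (metis (no_types) empty_iff)
  from continuous_attains_inf[OF cS this cont]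
  obtain s where s: "s \<in> ?S" "\<And>x. x \<in> ?S \<Longrightarrow> norm (?\<phi> s) \<le> norm (?\<phi> x)"
    by (elim bexE) (rule that, assumption, erule bspec)
  define \<mu> where "\<mu> = norm (?\<phi> s)"
  have "\<mu> > 0"
  proof (rule ccontr)
    assume "\<not> \<mu> > 0"
    then have "?\<phi> s = 0" by (simp add: \<mu>_def)
    then have "\<And>i. i < m \<Longrightarrow> s i = 0" using inj by blast
    then show False using s(1) by simp
  qed
  have bound: "\<bar>x i\<bar> \<le> (1/\<mu>) * norm (?\<phi> x)" if "i < m" for x i
  proof -
    define q where "q = sqrt (\<Sum>i<m. (x i)\<^sup>2)"
    have q0: "0 \<le> q" by (simp add: q_def sum_nonneg)
    have q2: "q\<^sup>2 = (\<Sum>i<m. (x i)\<^sup>2)" by (simp add: q_def sum_nonneg)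
    have xq: "\<bar>x j\<bar> \<le> q" if "j < m" for j
    proof -
      have "(x j)\<^sup>2 \<le> (\<Sum>i<m. (x i)\<^sup>2)"
        using that by (intro member_le_sum) auto
      then show ?thesis using q2 q0 by (metis abs_le_square_iff abs_of_nonneg)
    qed
    show ?thesis
    proof (cases "q = 0")
      case True
      then show ?thesis using xq[OF that] \<open>\<mu> > 0\<close> by simp
    next
      case False
      then have qp: "q > 0" using q0 by simp
      define y where "y = (\<lambda>i. if i < m then x i / q else 0)"
      have "(\<Sum>i<m. (y i)\<^sup>2) = (\<Sum>i<m. (x i)\<^sup>2) / q\<^sup>2"
        by (simp add: y_def power_divide sum_divide_distrib)
      then have "y \<in> ?S" using xq qp q2 by (auto simp: y_def)
      then have "\<mu> \<le> norm (?\<phi> y)" using s(2) by (simp add: \<mu>_def)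
      also have "?\<phi> y = ?\<phi> (\<lambda>i. (1/q) * x i)"
        by (rule lincomb_cong) (simp add: y_def)
      also have "\<dots> = (1/q) *\<^sub>R ?\<phi> x" by (rule lincomb_scale)
      finally have "\<mu> * q \<le> norm (?\<phi> x)" using qp by (simp add: field_simps)
      then have "q \<le> (1/\<mu>) * norm (?\<phi> x)" using \<open>\<mu> > 0\<close> by (simp add: field_simps)
      then show ?thesis using xq[OF that] by linarith
    qed
  qed
  show ?thesis by (rule that[of "1/\<mu>"]) (use \<open>\<mu> > 0\<close> bound in auto)
qed

definition coordinates_on ::
  "'a::real_normed_vector set \<Rightarrow> nat \<Rightarrow> (nat \<Rightarrow> 'a) \<Rightarrow> ('a \<Rightarrow> nat \<Rightarrow> real) \<Rightarrow> bool" where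
  "coordinates_on V m b k \<longleftrightarrow>
     (\<forall>x. lincomb m b x \<in> V) \<and>
     (\<forall>u\<in>V. lincomb m b (k u) = u) \<and>
     (\<forall>u. \<forall>i\<ge>m. k u i = 0) \<and>
     (\<forall>x. \<forall>i<m. k (lincomb m b x) i = x i) \<and>
     continuous_on V k \<and>
     (\<exists>K\<ge>0. \<forall>u\<in>V. \<forall>i. \<bar>k u i\<bar> \<le> K * norm u)"

lemma finite_dimensional_coordinates:
  fixes V :: "'a::real_normed_vector set"
  assumes "finite_dimensional V"
  shows "\<exists>m b k. coordinates_on V m b k"
proof -
  obtain E where E: "finite E" "span E = V" using assms by (auto simp: finite_dimensional_def)
  obtain B where B: "B \<subseteq> E" "independent B" "E \<subseteq> span B"
    by (meson maximal_independent_subset)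
  have finB: "finite B" using B E finite_subset by blast
  have sB: "span B = V" using B E by (metis span_eq span_superset subset_trans)
  obtain b m where b: "bij_betw b {..<m::nat} B"
    by (metis ex_bij_betw_nat_finite finB lessThan_atLeast0)
  let ?\<phi> = "lincomb m b"
  have inj: "x i = 0" if 0: "?\<phi> x = 0" and i: "i < m" for x i
  proof -
    define x' where "x' = (\<lambda>v. x (inv_into {..<m} b v))"
    have x': "x' (b j) = x j" if "j < m" for j
      using b that by (simp add: x'_def bij_betw_def inv_into_f_f)
    have "(\<Sum>v\<in>B. x' v *\<^sub>R v) = (\<Sum>j<m. x' (b j) *\<^sub>R b j)"
      using sum.reindex_bij_betw[OF b, of "\<lambda>v. x' v *\<^sub>R v"] by simp
    also have "\<dots> = 0" using 0 x' by (simp add: lincomb_def)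
    finally have "x' (b i) = 0"
      using independentD[OF B(2) finB order_refl] b i by (auto simp: bij_betw_def)
    then show ?thesis using x' i by simp
  qed
  have inV: "?\<phi> x \<in> V" for x
    unfolding sB[symmetric] lincomb_def using b by (intro span_sum span_scale span_base) (auto simp: bij_betw_def)
  have ex: "\<exists>x. (\<forall>i\<ge>m. x i = 0) \<and> ?\<phi> x = u" if "u \<in> V" for u
  proof -
    have "u \<in> span B" using that sB by simp
    then obtain w where w: "u = (\<Sum>v\<in>B. w v *\<^sub>R v)" using span_finite[OF finB] by auto
    have "u = (\<Sum>j<m. w (b j) *\<^sub>R b j)"
      using w sum.reindex_bij_betw[OF b, of "\<lambda>v. w v *\<^sub>R v"] by simp
    then have "?\<phi> (\<lambda>i. if i < m then w (b i) else 0) = u" by (simp add: lincomb_def)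
    then show ?thesis by (intro exI[of _ "\<lambda>i. if i < m then w (b i) else 0"]) auto
  qed
  define k where "k = (\<lambda>u. if u \<in> V then SOME x. (\<forall>i\<ge>m. x i = 0) \<and> ?\<phi> x = u else (\<lambda>_. 0))"
  have k: "k u i = 0" if "m \<le> i" for u i
    using someI_ex[OF ex[of u]] that by (auto simp: k_def)
  have \<phi>k: "?\<phi> (k u) = u" if "u \<in> V" for u
    using someI_ex[OF ex[OF that]] that by (auto simp: k_def)
  have uniq: "x i = y i" if "?\<phi> x = ?\<phi> y" "i < m" for x y i
    using inj[of "\<lambda>i. x i - y i" i] that by (simp add: lincomb_diff)
  have k\<phi>: "k (?\<phi> x) i = x i" if "i < m" for x i
    using uniq \<phi>k[OF inV] that by blast
  obtain K where K: "K \<ge> 0" "\<And>x i. i < m \<Longrightarrow> \<bar>x i\<bar> \<le> K * norm (?\<phi> x)"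
    using coefficient_bound[where m = m and b = b] inj by blast
  have kb: "\<bar>k u i\<bar> \<le> K * norm u" if "u \<in> V" for u i
    using K(2)[of i "k u"] \<phi>k[OF that] k[of i u] K(1) by (cases "i < m") auto
  have lip: "\<bar>k u i - k v i\<bar> \<le> K * norm (u - v)" if "u \<in> V" "v \<in> V" for u v i
    using K(2)[of i "\<lambda>i. k u i - k v i"] \<phi>k[OF that(1)] \<phi>k[OF that(2)] k[of i u] k[of i v] K(1)
    by (cases "i < m") (auto simp: lincomb_diff)
  have "continuous_on V (\<lambda>u. k u i)" for i
  proof (rule lipschitz_on_continuous_on)
    show "K-lipschitz_on V (\<lambda>u. k u i)"
      by (rule lipschitz_onI) (use lip K in \<open>auto simp: dist_norm\<close>)
  qed
  then have ck: "continuous_on V k" by (rule continuous_on_coordinatewise_then_product)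
  show ?thesis
    unfolding coordinates_on_def
    by (intro exI[of _ m] exI[of _ b] exI[of _ k] conjI exI[of _ K]) (use inV \<phi>k k k\<phi> ck kb K in auto)
qed

text \<open>Bounded coordinates put \<open>S\<close> into the continuous image of a compact box.\<close>

lemma finite_dimensional_compact:
  fixes V :: "'a::real_normed_vector set"
  assumes fin: "finite_dimensional V" and S: "S \<subseteq> V" "closed S" "bounded S"
  shows "compact S"
proof -
  obtain m b k where coords: "coordinates_on V m b k"
    using finite_dimensional_coordinates[OF fin] by blast
  have \<phi>k: "\<And>u. u \<in> V \<Longrightarrow> lincomb m b (k u) = u"
    and k0: "\<And>u i. m \<le> i \<Longrightarrow> k u i = 0"
    using coords by (simp_all add: coordinates_on_def)
  obtain K where K: "K \<ge> 0" "\<And>u i. u \<in> V \<Longrightarrow> \<bar>k u i\<bar> \<le> K * norm u"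
    using coords unfolding coordinates_on_def by blast
  obtain R where R: "\<And>u. u \<in> S \<Longrightarrow> norm u \<le> R" using S(3) bounded_iff by blast
  let ?\<phi> = "lincomb m b"
  let ?box = "{x :: nat \<Rightarrow> real. (\<forall>i<m. \<bar>x i\<bar> \<le> K * R) \<and> (\<forall>i\<ge>m. x i = 0)}"
  have comp: "compact (?\<phi> ` ?box)"
    by (intro compact_continuous_image compact_box_nat continuous_on_lincomb)
  have "S \<subseteq> ?\<phi> ` ?box"
  proof
    fix u assume u: "u \<in> S"
    then have "\<bar>k u i\<bar> \<le> K * R" for i
      using K R S(1) by (meson mult_left_mono order_trans subsetD)
    then have "k u \<in> ?box" using k0 by simp
    moreover have "u = ?\<phi> (k u)" using \<phi>k u S(1) by auto
    ultimately show "u \<in> ?\<phi> ` ?box" by blast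
  qed
  then have "?\<phi> ` ?box \<inter> S = S" by blast
  then show ?thesis
    using compact_Int_closed[OF comp S(2)] by (rule subst)
qed

text \<open>A form of Brouwer's no-retraction theorem. The closed set \<open>W\<close> plays the role of the closure of
  the outside of \<open>M\<close>, and \<open>M \<inter> W\<close> that of the frontier. Extend \<open>H\<close> by the identity on \<open>W\<close> to a
  map \<open>G\<close> of the whole space. If \<open>G\<close> missed \<open>p\<close>, then normalising \<open>G (p + t R x) - p\<close> for
  \<open>0 \<le> t \<le> 1\<close> would give a homotopy of the unit sphere from a constant map (at \<open>t = 0\<close>) to the
  identity (at \<open>t = 1\<close>, as the sphere of large radius \<open>R\<close> about \<open>p\<close> lies outside \<open>M\<close>); but
  spheres are not contractible. Working with \<open>G\<close> avoids a homeomorphism between \<open>M\<close> and a ball.\<close>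

lemma identity_on_frontier_covers:
  fixes V :: "'a::real_normed_vector set"
  assumes fin: "finite_dimensional V" and ntriv: "v0 \<in> V" "v0 \<noteq> 0"
    and MW: "closed M" "closed W" "M \<union> W = V" and bM: "bounded M"
    and H: "continuous_on M H" "H ` M \<subseteq> V" "\<And>u. u \<in> M \<inter> W \<Longrightarrow> H u = u"
    and p: "p \<in> M"
  shows "p \<in> H ` M"
proof (rule ccontr)
  assume miss: "p \<notin> H ` M"
  obtain m b k where coords: "coordinates_on V m b k"
    using finite_dimensional_coordinates[OF fin] by blast
  have inV: "\<And>x. lincomb m b x \<in> V"
    and \<phi>k: "\<And>u. u \<in> V \<Longrightarrow> lincomb m b (k u) = u"
    and k0: "\<And>u i. m \<le> i \<Longrightarrow> k u i = 0"
    and k\<phi>: "\<And>x i. i < m \<Longrightarrow> k (lincomb m b x) i = x i"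
    and ck: "continuous_on V k"
    using coords by (simp_all add: coordinates_on_def)
  obtain K where K: "K \<ge> 0" "\<And>u i. u \<in> V \<Longrightarrow> \<bar>k u i\<bar> \<le> K * norm u"
    using coords unfolding coordinates_on_def by blast
  let ?\<phi> = "lincomb m b"
  have subV: "subspace V"
    using fin by (auto simp: finite_dimensional_def)
  have pV: "p \<in> V" using p MW by blast
  obtain n where n: "m = Suc n"
  proof (cases m)
    case 0
    then show ?thesis using \<phi>k[OF ntriv(1)] ntriv(2) by (simp add: lincomb_def)
  qed
  define G where "G = (\<lambda>u. if u \<in> M then H u else u)"
  have cG: "continuous_on V G"
    unfolding G_def MW(3)[symmetric]
    by (rule continuous_on_cases) (use MW H in \<open>auto intro: continuous_on_id\<close>)
  have GV: "G u \<in> V" if "u \<in> V" for u using H(2) that by (auto simp: G_def)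
  have Gp: "G u \<noteq> p" if "u \<in> V" for u using miss p by (auto simp: G_def)
  obtain R0 where R0: "\<And>u. u \<in> M \<Longrightarrow> norm u \<le> R0" using bM bounded_iff by blast
  let ?S = "topspace (nsphere n)"
  have S: "?S = {x. (\<forall>i\<ge>m. x i = 0) \<and> (\<Sum>i<m. (x i)\<^sup>2) = 1}"
    by (auto simp: nsphere topspace_Euclidean_space n lessThan_Suc_atMost)
  \<comment> \<open>Unit coefficient vectors give vectors of norm at least \<open>1 / (m K)\<close>, so any
    \<open>R \<ge> m K D\<close> works, where \<open>D\<close> exceeds the distance from \<open>p\<close> to any point of \<open>M\<close>;
    \<open>K + 1\<close> in place of \<open>K\<close> keeps \<open>R\<close> positive.\<close>
  obtain R where R: "R > 0" "\<And>x. x \<in> ?S \<Longrightarrow> p + R *\<^sub>R ?\<phi> x \<notin> M"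
  proof -
    have big: "1 \<le> m * (K * norm (?\<phi> x))^2" if x: "x \<in> ?S" for x
    proof -
      have "1 = (\<Sum>i<m. (x i)\<^sup>2)" using x S by auto
      also have "\<dots> \<le> (\<Sum>i<m. (K * norm (?\<phi> x))^2)"
      proof (rule sum_mono)
        fix i assume "i \<in> {..<m}"
        then have "\<bar>x i\<bar> \<le> K * norm (?\<phi> x)" using K(2)[OF inV[of x], of i] k\<phi>[of i x] by simp
        then show "(x i)\<^sup>2 \<le> (K * norm (?\<phi> x))^2" by (metis abs_ge_zero power2_abs power_mono)
      qed
      finally show ?thesis by simp
    qed
    define D where "D = norm p + \<bar>R0\<bar> + 1"
    have D: "D > 0" by (simp add: D_def add_nonneg_pos)
    define R where "R = D * m * (K + 1)"
    have "R > 0" unfolding R_def using D n K by (simp add: mult_pos_pos)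
    moreover have "p + R *\<^sub>R ?\<phi> x \<notin> M" if x: "x \<in> ?S" for x
    proof
      assume "p + R *\<^sub>R ?\<phi> x \<in> M"
      then have "norm (p + R *\<^sub>R ?\<phi> x) \<le> \<bar>R0\<bar>" using R0 by force
      then have "norm (R *\<^sub>R ?\<phi> x) \<le> norm p + \<bar>R0\<bar>"
        using norm_triangle_ineq2[of "R *\<^sub>R ?\<phi> x" "- p"] by (simp add: add.commute)
      then have le: "R * norm (?\<phi> x) < D" using \<open>R > 0\<close> by (simp add: D_def)
      have "1 \<le> m * (K * norm (?\<phi> x))"
      proof (rule ccontr)
        let ?a = "K * norm (?\<phi> x)"
        assume "\<not> 1 \<le> m * ?a"
        then have lt: "m * ?a < 1" by simp
        have a0: "0 \<le> ?a" using K by simp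
        have "?a \<le> m * ?a" using mult_right_mono[of 1 "real m" ?a] a0 n by simp
        then have "?a < 1" using lt by simp
        then have "m * ?a^2 \<le> m * ?a" using a0 by (simp add: power2_eq_square mult_left_le mult_left_mono)
        then show False using big[OF x] lt by linarith
      qed
      also have "\<dots> \<le> m * ((K + 1) * norm (?\<phi> x))" by (intro mult_left_mono mult_right_mono) auto
      finally have "D \<le> D * (m * ((K + 1) * norm (?\<phi> x)))" using D by simp
      then show False using le by (simp add: R_def algebra_simps)
    qed
    ultimately show thesis using that by blast
  qed
  \<comment> \<open>\<open>h\<close> is the normalised displacement \<open>F\<close> from \<open>p\<close>, read in coordinates.\<close>
  define F where "F = (\<lambda>q::real \<times> (nat \<Rightarrow> real). G (p + (fst q * R) *\<^sub>R ?\<phi> (snd q)) - p)"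
  define N where "N = (\<lambda>q. sqrt (\<Sum>i<m. (k (F q) i)\<^sup>2))"
  define h where "h = (\<lambda>q i. k (F q) i / N q)"
  have arg: "p + (t * R) *\<^sub>R ?\<phi> x \<in> V" for t x
    using subV pV inV by (meson subspace_add subspace_scale)
  have FV: "F q \<in> V" for q
    unfolding F_def using GV[OF arg] pV subV by (simp add: subspace_diff)
  have c\<phi>: "continuous_on UNIV (\<lambda>q::real \<times> (nat \<Rightarrow> real). ?\<phi> (snd q))"
    by (rule continuous_on_compose2[OF continuous_on_lincomb[of UNIV]]) (auto intro: continuous_intros)
  have cF: "continuous_on UNIV F"
    unfolding F_def
    by (intro continuous_intros continuous_on_compose2[OF cG] c\<phi>) (use arg in auto)
  have ckF: "continuous_on UNIV (\<lambda>q. k (F q) i)" for i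
    by (rule continuous_on_product_then_coordinatewise)
      (rule continuous_on_compose2[OF ck cF], use FV in auto)
  have Npos: "N q > 0" for q
  proof (rule ccontr)
    assume "\<not> N q > 0"
    then have "(\<Sum>i<m. (k (F q) i)\<^sup>2) \<le> 0" by (simp add: N_def)
    then have "(\<Sum>i<m. (k (F q) i)\<^sup>2) = 0"
      by (meson dual_order.antisym sum_nonneg zero_le_power2)
    then have "\<And>i. i < m \<Longrightarrow> k (F q) i = 0"
      by (subst (asm) sum_nonneg_eq_0_iff) auto
    then have "?\<phi> (k (F q)) = 0" by (rule lincomb_zero)
    then have "F q = 0" using \<phi>k[OF FV] by metis
    then show False using Gp[OF arg] by (simp add: F_def)
  qed
  have N2: "(N q)\<^sup>2 = (\<Sum>i<m. (k (F q) i)\<^sup>2)" for q by (simp add: N_def sum_nonneg)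
  have ch: "continuous_on UNIV h"
  proof (rule continuous_on_coordinatewise_then_product)
    show "continuous_on UNIV (\<lambda>q. h q i)" for i
      unfolding h_def by (rule continuous_on_divide[OF ckF])
        (use Npos in \<open>auto simp: N_def intro!: continuous_intros ckF simp: less_le\<close>)
  qed
  have hS: "h q \<in> ?S" for q
  proof -
    have "(\<Sum>i<m. (h q i)\<^sup>2) = (\<Sum>i<m. (k (F q) i)\<^sup>2) / (N q)\<^sup>2"
      by (simp add: h_def power_divide sum_divide_distrib)
    also have "\<dots> = 1" using Npos[of q] unfolding N2[symmetric] by simp
    finally show ?thesis unfolding S using k0 by (simp add: h_def)
  qed
  have h0: "h (0, x) = h (0, undefined)" for x by (simp add: h_def N_def F_def)
  have h1: "h (1, x) = x" if x: "x \<in> ?S" for x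
  proof -
    have F1: "F (1, x) = ?\<phi> (\<lambda>i. R * x i)"
      using R(2)[OF x] by (simp add: F_def G_def lincomb_scale)
    have kF: "k (F (1, x)) i = R * x i" for i
      using k\<phi>[of i "\<lambda>i. R * x i"] k0[of i "F (1,x)"] x by (cases "i < m") (auto simp: F1 S)
    have "(N (1,x))\<^sup>2 = R\<^sup>2"
      using x by (simp add: N2 kF power_mult_distrib S flip: sum_distrib_left)
    then have "N (1,x) = R" using Npos[of "(1,x)"] R(1) by (simp add: power2_eq_iff)
    then show ?thesis using R(1) by (auto simp: h_def kF)
  qed
  have ns: "nsphere n = top_of_set ?S"
    unfolding nsphere_def Euclidean_space_def euclidean_product_topology subtopology_subtopology
    by simp
  have "homotopic_with_canon (\<lambda>_. True) ?S ?S (\<lambda>x. h (0, undefined)) id"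
  proof (subst homotopic_with, simp, intro exI[of _ h] conjI ballI)
    show "continuous_map (prod_topology (top_of_set {0..1}) (top_of_set ?S)) (top_of_set ?S) h"
      using ch hS by (auto simp: prod_topology_subtopology subtopology_subtopology
          intro: continuous_on_subset)
  next
    show "h (0, x) = h (0, undefined)" for x by (rule h0)
    show "h (1, x) = id x" if "x \<in> topspace (top_of_set ?S)" for x
      using h1 that by simp
  qed simp
  then have "contractible_space (nsphere n)"
    unfolding contractible_space_def ns[symmetric] by (blast intro: homotopic_with_symD)
  then show False using non_contractible_space_nsphere by blast
qed

section \<open>Ekeland's principle and a minimax principle\<close>

text \<open>The relation \<open>\<phi> y + \<sigma> d x y \<le> \<phi> x\<close> is a partial order by the triangle inequality. Descend along
  it, at step \<open>k\<close> to within \<open>2^-k\<close> of the infimum over all points below the current one. The values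
  decrease, so the points form a Cauchy sequence. Its limit lies below every term by lower
  semicontinuity, and any point below the limit has the same value. Semicontinuity and closedness
  of \<open>C\<close> enter through the single assumption on convergent sequences in \<open>C\<close>.\<close>

lemma (in Metric_space) ekeland_variational_principle:
  fixes \<phi> :: "'a \<Rightarrow> real"
  assumes complete: "mcomplete" and C: "C \<subseteq> M" "x0 \<in> C" and \<sigma>: "\<sigma> > 0"
    and lower: "\<And>x. x \<in> C \<Longrightarrow> c \<le> \<phi> x"
    and lsc: "\<And>s x a. \<lbrakk>range s \<subseteq> C; limitin mtopology s x sequentially;
                \<forall>\<^sub>F n in sequentially. \<phi> (s n) \<le> a\<rbrakk> \<Longrightarrow> x \<in> C \<and> \<phi> x \<le> a"
  obtains x where "x \<in> C" "\<phi> x + \<sigma> * d x0 x \<le> \<phi> x0"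
    and "\<And>y. y \<in> C \<Longrightarrow> \<phi> x \<le> \<phi> y + \<sigma> * d x y"
proof -
  define S where "S = (\<lambda>x. {y \<in> C. \<phi> y + \<sigma> * d x y \<le> \<phi> x})"
  have S_trans: "z \<in> S x" if "y \<in> S x" "z \<in> S y" "x \<in> C" for x y z
  proof -
    have "d x z \<le> d x y + d y z" using that C by (auto simp: S_def intro!: triangle)
    then have "\<sigma> * d x z \<le> \<sigma> * d x y + \<sigma> * d y z"
      using \<sigma> by (metis distrib_left mult_left_mono less_imp_le)
    then show ?thesis using that by (auto simp: S_def)
  qed
  have S_refl: "x \<in> S x" if "x \<in> C" for x using that C by (auto simp: S_def)
  have step: "\<exists>y. (y \<in> C) \<and> y \<in> S x \<and> (\<forall>w\<in>S x. \<phi> y \<le> \<phi> w + (1/2)^k)" if xC: "x \<in> C" for x k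
  proof -
    have bdd: "bdd_below (\<phi> ` S x)"
      using lower by (intro bdd_belowI[of _ c]) (auto simp: S_def)
    have "(INF w\<in>S x. \<phi> w) < (INF w\<in>S x. \<phi> w) + (1/2)^k" by simp
    then obtain y where y: "y \<in> S x" "\<phi> y < (INF w\<in>S x. \<phi> w) + (1/2)^k"
      using cINF_less_iff[OF _ bdd] S_refl[OF xC] by blast
    have "\<phi> y \<le> \<phi> w + (1/2)^k" if "w \<in> S x" for w
      using y(2) cINF_lower[OF bdd that] by linarith
    then show ?thesis using y(1) by (auto simp: S_def)
  qed
  obtain s where s0: "s 0 = x0" and sC: "\<And>n. s n \<in> C"
    and sS: "\<And>n. s (Suc n) \<in> S (s n)"
    and smin: "\<And>n w. w \<in> S (s n) \<Longrightarrow> \<phi> (s (Suc n)) \<le> \<phi> w + (1/2)^n"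
  proof -
    have "\<exists>s. s 0 = x0 \<and> (\<forall>n. s n \<in> C \<and> (s (Suc n) \<in> S (s n) \<and>
        (\<forall>w\<in>S (s n). \<phi> (s (Suc n)) \<le> \<phi> w + (1/2)^n)))"
      using dependent_nat_choice[of "\<lambda>n x. x \<in> C \<and> (n = 0 \<longrightarrow> x = x0)"
          "\<lambda>n x y. y \<in> S x \<and> (\<forall>w\<in>S x. \<phi> y \<le> \<phi> w + (1/2)^n)"] C(2) step by auto
    then show thesis using that by blast
  qed
  have sS': "s m \<in> S (s n)" if "n \<le> m" for n m
    using that
  proof (induction m rule: dec_induct)
    case base
    show ?case by (rule S_refl[OF sC])
  next
    case (step m)
    then show ?case using S_trans[OF _ sS sC] by blast
  qed
  then have sd: "\<phi> (s m) + \<sigma> * d (s n) (s m) \<le> \<phi> (s n)" if "n \<le> m" for n m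
    using that by (auto simp: S_def)
  have dec: "decseq (\<lambda>n. \<phi> (s n))"
  proof (rule decseq_SucI)
    fix n
    show "\<phi> (s (Suc n)) \<le> \<phi> (s n)"
      using sd[of n "Suc n"] mult_nonneg_nonneg[OF less_imp_le[OF \<sigma>] nonneg[of "s n" "s (Suc n)"]]
      by simp
  qed
  obtain l where l: "(\<lambda>n. \<phi> (s n)) \<longlonglongrightarrow> l"
    using decseq_convergent[OF dec] lower[OF sC] by metis
  have "MCauchy s"
    unfolding MCauchy_def
  proof (intro conjI allI impI)
    show "range s \<subseteq> M" using sC C by auto
    fix e :: real assume "e > 0"
    then have "\<sigma> * e > 0" using \<sigma> by simp
    then obtain N where N: "\<And>n. n \<ge> N \<Longrightarrow> dist (\<phi> (s n)) l < \<sigma> * e / 2"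
      using l by (metis lim_sequentially half_gt_zero)
    have *: "d (s n) (s m) < e" if "N \<le> n" "n \<le> m" for n m
    proof -
      have "\<sigma> * d (s n) (s m) < \<sigma> * e"
        using sd[OF that(2)] N[of n] N[of m] that unfolding dist_real_def by linarith
      then show ?thesis using \<sigma> by simp
    qed
    show "\<exists>N. \<forall>n n'. N \<le> n \<longrightarrow> N \<le> n' \<longrightarrow> d (s n) (s n') < e"
      using * commute by (metis nle_le)
  qed
  then obtain x where x: "limitin mtopology s x sequentially"
    using complete by (auto simp: mcomplete_def)
  have xC: "x \<in> C"
    using lsc[OF _ x, of "\<phi> (s 0)"] sC decseqD[OF dec] by auto
  have x_S: "x \<in> S (s n)" for n
  proof -
    have "\<phi> x \<le> \<phi> (s n) - \<sigma> * d (s n) x"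
    proof (rule field_le_epsilon)
      fix e :: real assume "e > 0"
      then have "e / \<sigma> > 0" using \<sigma> by simp
      then have "\<forall>\<^sub>F m in sequentially. s m \<in> M \<and> d (s m) x < e / \<sigma>"
        using x by (simp add: limitin_metric)
      then have "\<forall>\<^sub>F m in sequentially. \<phi> (s m) \<le> \<phi> (s n) - \<sigma> * d (s n) x + e"
        using eventually_ge_at_top[of n]
      proof eventually_elim
        case (elim m)
        have "d (s n) x \<le> d (s n) (s m) + d (s m) x" using sC xC C by (intro triangle) auto
        then have "d (s n) x \<le> d (s n) (s m) + e / \<sigma>" using elim by linarith
        then have "\<sigma> * d (s n) x \<le> \<sigma> * (d (s n) (s m) + e / \<sigma>)" using \<sigma> by simp
        also have "\<dots> = \<sigma> * d (s n) (s m) + e" using \<sigma> by (simp add: field_simps)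
        finally show ?case using sd[OF elim(2)] by linarith
      qed
      then show "\<phi> x \<le> \<phi> (s n) - \<sigma> * d (s n) x + e"
        using lsc[OF _ x] sC by blast
    qed
    then show ?thesis using xC by (simp add: S_def)
  qed
  show ?thesis
  proof (rule that[OF xC])
    show "\<phi> x + \<sigma> * d x0 x \<le> \<phi> x0" using x_S[of 0] s0 by (simp add: S_def)
    fix y assume y: "y \<in> C"
    show "\<phi> x \<le> \<phi> y + \<sigma> * d x y"
    proof (rule ccontr)
      assume n: "\<not> \<phi> x \<le> \<phi> y + \<sigma> * d x y"
      \<comment> \<open>Then \<open>y\<close> lies below all terms of the sequence, whose values almost minimise.\<close>
      then have yS: "y \<in> S (s k)" for k
        using S_trans[OF x_S _ sC, of y k] y by (simp add: S_def)
      have "\<phi> x \<le> \<phi> y + (1/2)^k" for k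
        using smin[OF yS[of k]] x_S[of "Suc k"]
          mult_nonneg_nonneg[OF less_imp_le[OF \<sigma>] nonneg[of "s (Suc k)" x]]
        by (simp add: S_def)
      moreover have "(\<lambda>k. \<phi> y + (1/2::real)^k) \<longlonglongrightarrow> \<phi> y + 0"
        by (intro tendsto_intros LIMSEQ_power_zero) simp
      ultimately have "\<phi> x \<le> \<phi> y"
        using LIMSEQ_le_const by (metis add.right_neutral)
      moreover have "0 \<le> \<sigma> * d x y" using \<sigma> nonneg by simp
      ultimately show False using n by linarith
    qed
  qed
qed

text \<open>A locally constant choice that satisfies a convex condition can be made globally and
  continuously by averaging with a partition of unity; here the weights are the tent functions
  \<open>max 0 (r x - dist x y)\<close> of a finite subcover, divided by their sum.\<close>

lemma convex_valued_selection:
  fixes P :: "'b::metric_space \<Rightarrow> 'a::real_normed_vector \<Rightarrow> bool"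
  assumes cM: "compact M"
    and conv: "\<And>x. x \<in> M \<Longrightarrow> convex {e. P x e}"
    and loc: "\<And>x. x \<in> M \<Longrightarrow> \<exists>e. \<exists>\<delta>>0. \<forall>y\<in>M. dist x y < \<delta> \<longrightarrow> P y e"
  obtains v where "continuous_on M v" "\<And>x. x \<in> M \<Longrightarrow> P x (v x)"
proof -
  obtain e r where er: "\<And>x. x \<in> M \<Longrightarrow> r x > 0"
      "\<And>x y. \<lbrakk>x \<in> M; y \<in> M; dist x y < r x\<rbrakk> \<Longrightarrow> P y (e x)"
    using loc by metis
  obtain D where D: "D \<subseteq> M" "finite D" "M \<subseteq> (\<Union>x\<in>D. ball x (r x))"
    by (rule compactE_image[OF cM, of M "\<lambda>x. ball x (r x)"]) (use er in auto)
  define f where "f = (\<lambda>x y. max 0 (r x - dist x y))"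
  define s where "s = (\<lambda>y. \<Sum>x\<in>D. f x y)"
  have f0: "f x y \<ge> 0" for x y by (simp add: f_def)
  have s0: "s y > 0" if y: "y \<in> M" for y
  proof -
    obtain x where x: "x \<in> D" "dist x y < r x" using D(3) y by auto
    then have "0 < f x y" by (simp add: f_def)
    also have "\<dots> \<le> s y" unfolding s_def using D x f0 by (intro member_le_sum) auto
    finally show ?thesis .
  qed
  define v where "v = (\<lambda>y. \<Sum>x\<in>D. (f x y / s y) *\<^sub>R e x)"
  have cf: "continuous_on M (f x)" for x
    unfolding f_def by (intro continuous_intros)
  have cs: "continuous_on M s"
    unfolding s_def by (intro continuous_on_sum cf)
  have "continuous_on M v"
    unfolding v_def
    by (intro continuous_intros cf cs) (use s0 in force)
  moreover have "P y (v y)" if y: "y \<in> M" for y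
  proof -
    let ?D = "{x \<in> D. f x y > 0}"
    have "v y = (\<Sum>x\<in>?D. (f x y / s y) *\<^sub>R e x)"
      unfolding v_def using D f0 by (intro sum.mono_neutral_right) (auto simp: less_le)
    moreover have "\<dots> \<in> {e. P y e}"
    proof (rule convex_sum)
      show "(\<Sum>x\<in>?D. f x y / s y) = 1"
      proof -
        have "(\<Sum>x\<in>?D. f x y) = s y"
          unfolding s_def using D f0 by (intro sum.mono_neutral_left) (auto simp: less_le)
        then show ?thesis using s0[OF y] by (simp flip: sum_divide_distrib)
      qed
      show "convex {e. P y e}" using conv y .
      fix x assume "x \<in> ?D"
      then show "e x \<in> {e. P y e}" using D er(2)[of x y] y by (auto simp: f_def)
    qed (use D f0 s0[OF y] in \<open>auto intro: less_imp_le\<close>)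
    ultimately show ?thesis by simp
  qed
  ultimately show thesis by (rule that)
qed

lemma mean_value_along_segment:
  fixes I :: "'a::real_normed_vector \<Rightarrow> real"
  assumes deriv: "\<And>u. (I has_derivative blinfun_apply (I' u)) (at u)" and "t > 0"
  obtains \<theta> where "0 < \<theta>" "\<theta> < t" "I (a + t *\<^sub>R w) - I a = t * blinfun_apply (I' (a + \<theta> *\<^sub>R w)) w"
proof -
  have "((\<lambda>\<tau>. I (a + \<tau> *\<^sub>R w)) has_real_derivative blinfun_apply (I' (a + \<tau> *\<^sub>R w)) w) (at \<tau>)" for \<tau>
  proof -
    have "((\<lambda>\<tau>. I (a + \<tau> *\<^sub>R w)) has_derivative (\<lambda>h. blinfun_apply (I' (a + \<tau> *\<^sub>R w)) (h *\<^sub>R w))) (at \<tau>)"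
      by (rule has_derivative_compose[OF _ deriv]) (auto intro!: derivative_eq_intros)
    moreover have "(\<lambda>h. blinfun_apply (I' (a + \<tau> *\<^sub>R w)) (h *\<^sub>R w)) = (*) (blinfun_apply (I' (a + \<tau> *\<^sub>R w)) w)"
      by (simp add: fun_eq_iff blinfun.scaleR_right)
    ultimately show ?thesis by (simp add: has_field_derivative_def)
  qed
  from MVT2[OF assms(2) this] show thesis using that by (force simp: mult.commute)
qed

lemma norm_blinfun_descent:
  fixes f :: "'a::real_normed_vector \<Rightarrow>\<^sub>L real"
  assumes "norm f > \<sigma>" "\<sigma> \<ge> 0"
  obtains e where "norm e \<le> 1" "blinfun_apply f e < - \<sigma>"
proof -
  have "\<exists>x. \<not> \<bar>blinfun_apply f x\<bar> \<le> \<sigma> * norm x"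
  proof (rule ccontr)
    assume "\<nexists>x. \<not> \<bar>blinfun_apply f x\<bar> \<le> \<sigma> * norm x"
    then have "norm f \<le> \<sigma>" using assms(2) by (intro norm_blinfun_bound) auto
    then show False using assms(1) by simp
  qed
  then obtain x where x: "\<bar>blinfun_apply f x\<bar> > \<sigma> * norm x" by (auto simp: not_le)
  then have x0: "norm x > 0" by (cases "x = 0") (auto simp: blinfun.zero_right)
  define e where "e = (- sgn (blinfun_apply f x) / norm x) *\<^sub>R x"
  have "norm e \<le> 1" using x0 by (simp add: e_def abs_sgn_eq)
  have "blinfun_apply f e = - \<bar>blinfun_apply f x\<bar> / norm x"
    by (simp add: e_def blinfun.scaleR_right blinfun.minus_right abs_sgn)
  moreover have "\<sigma> < \<bar>blinfun_apply f x\<bar> / norm x" using x x0 by (simp add: pos_less_divide_eq)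
  ultimately have "blinfun_apply f e < - \<sigma>" by simp
  with \<open>norm e \<le> 1\<close> show thesis by (rule that)
qed

text \<open>A selection \<open>v\<close> of directions that strictly decrease \<open>I\<close> at the maximum points of \<open>I \<circ> h\<close> and
  vanish on \<open>K\<close> lowers the maximum at rate more than \<open>\<sigma>\<close>. The step size \<open>t\<close> is found by
  contradiction: if no \<open>t\<close> worked, points violating the estimate for \<open>t \<longlongrightarrow> 0\<close> would accumulate at
  a maximum point \<open>l\<close>, and the mean value theorem would yield \<open>I' (h l) (v l) \<ge> - \<sigma>\<close>.\<close>

lemma descent_perturbation:
  fixes I :: "'a::real_normed_vector \<Rightarrow> real" and h :: "'b::metric_space \<Rightarrow> 'a"
  assumes deriv: "\<And>u. (I has_derivative blinfun_apply (I' u)) (at u)"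
    and cI': "continuous_on UNIV I'"
    and cM: "compact M" and K: "closed K" and ch: "continuous_on M h"
    and le: "\<And>u. u \<in> M \<Longrightarrow> I (h u) \<le> s"
    and ltK: "\<And>u. u \<in> M \<inter> K \<Longrightarrow> I (h u) < s"
    and steep: "\<And>u. \<lbrakk>u \<in> M; I (h u) = s\<rbrakk> \<Longrightarrow> norm (I' (h u)) > \<sigma>" and \<sigma>: "\<sigma> \<ge> 0"
  obtains v t where "t > 0" "continuous_on M v" "\<And>u. u \<in> M \<Longrightarrow> norm (v u) \<le> 1"
    "\<And>u. u \<in> M \<inter> K \<Longrightarrow> v u = 0" "\<And>u. u \<in> M \<Longrightarrow> I (h u + t *\<^sub>R v u) < s - \<sigma> * t"
proof -
  have cI: "continuous_on UNIV I"
    using deriv by (meson continuous_at_imp_continuous_on has_derivative_continuous)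
  have cIh: "continuous_on M (\<lambda>u. I (h u))"
    by (rule continuous_on_compose2[OF cI ch]) auto
  define P where "P = (\<lambda>x e. norm e \<le> 1 \<and> (x \<in> K \<longrightarrow> e = 0) \<and>
     (I (h x) = s \<longrightarrow> blinfun_apply (I' (h x)) e < - \<sigma>))"
  obtain v where v: "continuous_on M v" "\<And>x. x \<in> M \<Longrightarrow> P x (v x)"
  proof (rule convex_valued_selection[OF cM])
    fix x assume x: "x \<in> M"
    have "{e. P x e} = cball 0 1 \<inter> {e. x \<in> K \<longrightarrow> e = 0} \<inter>
        {e. I (h x) = s \<longrightarrow> blinfun_apply (I' (h x)) e < - \<sigma>}"
      by (auto simp: P_def)
    moreover have "convex {e::'a. x \<in> K \<longrightarrow> e = 0}" by (cases "x \<in> K") auto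
    moreover have "convex {e. I (h x) = s \<longrightarrow> blinfun_apply (I' (h x)) e < - \<sigma>}"
    proof (cases "I (h x) = s")
      case True
      have "convex (blinfun_apply (I' (h x)) -` {..< - \<sigma>})"
        by (rule convex_linear_vimage)
          (simp_all add: blinfun.bounded_linear_right bounded_linear.linear)
      then show ?thesis using True by (simp add: vimage_def)
    qed auto
    ultimately show "convex {e. P x e}" by (simp add: convex_Int)
    show "\<exists>e. \<exists>\<delta>>0. \<forall>y\<in>M. dist x y < \<delta> \<longrightarrow> P y e"
    proof (cases "I (h x) = s")
      case True
      then obtain e where e: "norm e \<le> 1" "blinfun_apply (I' (h x)) e < - \<sigma>"
        using norm_blinfun_descent[OF steep[OF x True] \<sigma>] by blast
      have "continuous_on M (\<lambda>y. blinfun_apply (I' (h y)) e)"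
        by (intro continuous_intros continuous_on_compose2[OF cI' ch]) auto
      then have "((\<lambda>y. blinfun_apply (I' (h y)) e) \<longlongrightarrow> blinfun_apply (I' (h x)) e) (at x within M)"
        using x by (simp add: continuous_on_def)
      then have "\<forall>\<^sub>F y in at x within M. blinfun_apply (I' (h y)) e < - \<sigma>"
        using e(2) by (rule order_tendstoD)
      then obtain d1 where d1: "d1 > 0" "\<And>y. \<lbrakk>y \<in> M; dist y x < d1\<rbrakk> \<Longrightarrow> blinfun_apply (I' (h y)) e < - \<sigma>"
        using e(2) unfolding eventually_at by (metis zero_less_dist_iff)
      have "x \<notin> K" using ltK x True by force
      then obtain d2 where d2: "d2 > 0" "\<And>y. dist y x < d2 \<Longrightarrow> y \<notin> K"
        using K by (metis Compl_iff open_Compl open_dist)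
      show ?thesis
        by (intro exI[of _ e] exI[of _ "min d1 d2"])
          (use d1 d2 e in \<open>auto simp: P_def dist_commute\<close>)
    next
      case False
      then have "I (h x) < s" using le x by force
      moreover have "((\<lambda>y. I (h y)) \<longlongrightarrow> I (h x)) (at x within M)"
        using x cIh by (simp add: continuous_on_def)
      ultimately have "\<forall>\<^sub>F y in at x within M. I (h y) < s"
        by (metis order_tendstoD(2))
      then obtain d where d: "d > 0" "\<And>y. \<lbrakk>y \<in> M; dist y x < d\<rbrakk> \<Longrightarrow> I (h y) < s"
        using \<open>I (h x) < s\<close> unfolding eventually_at by (metis zero_less_dist_iff)
      show ?thesis
        by (intro exI[of _ 0] exI[of _ d]) (use d in \<open>force simp: P_def dist_commute\<close>)
    qed
  qed blast
  have "\<exists>t>0. \<forall>u\<in>M. I (h u + t *\<^sub>R v u) < s - \<sigma> * t"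
  proof (rule ccontr)
    assume "\<not> ?thesis"
    then have "\<exists>x\<in>M. s - \<sigma> * t \<le> I (h x + t *\<^sub>R v x)" if "t > 0" for t
      using that by (meson not_le)
    then have "\<forall>n. \<exists>x\<in>M. s - \<sigma> * (1 / Suc n) \<le> I (h x + (1 / Suc n) *\<^sub>R v x)"
      by (meson divide_pos_pos of_nat_0_less_iff zero_less_Suc zero_less_one)
    then obtain x where x: "\<And>n. x n \<in> M"
        "\<And>n. s - \<sigma> * (1 / Suc n) \<le> I (h (x n) + (1 / Suc n) *\<^sub>R v (x n))"
      by metis
    obtain l q where l: "l \<in> M" "strict_mono q" "(x \<circ> q) \<longlonglongrightarrow> l"
      using cM x(1) unfolding compact_def by (metis (no_types))
    define t where "t = (\<lambda>n. 1 / real (Suc (q n)))"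
    have t0: "t n > 0" for n by (simp add: t_def)
    have tlim: "t \<longlonglongrightarrow> 0"
      using LIMSEQ_subseq_LIMSEQ[OF LIMSEQ_inverse_real_of_nat l(2)]
      by (simp add: t_def o_def inverse_eq_divide)
    have hlim: "(\<lambda>n. h (x (q n))) \<longlonglongrightarrow> h l" and vlim: "(\<lambda>n. v (x (q n))) \<longlonglongrightarrow> v l"
      using continuous_on_tendsto_compose[OF ch l(3)] continuous_on_tendsto_compose[OF v(1) l(3)] l(1) x(1)
      by (auto simp: o_def)
    have shift: "(\<lambda>n. h (x (q n)) + \<theta> n *\<^sub>R v (x (q n))) \<longlonglongrightarrow> h l" if "\<theta> \<longlonglongrightarrow> 0" for \<theta>
      using tendsto_add[OF hlim tendsto_scaleR[OF that vlim]] by simp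
    have "(\<lambda>n. I (h (x (q n)) + t n *\<^sub>R v (x (q n)))) \<longlonglongrightarrow> I (h l)"
      by (rule continuous_on_tendsto_compose[OF cI shift[OF tlim]]) auto
    moreover have "(\<lambda>n. s - \<sigma> * t n) \<longlonglongrightarrow> s - \<sigma> * 0"
      by (intro tendsto_intros tlim)
    ultimately have "s - \<sigma> * 0 \<le> I (h l)"
      using x(2) by (intro LIMSEQ_le) (auto simp: t_def)
    then have "I (h l) = s" using le[OF l(1)] by simp
    then have neg: "blinfun_apply (I' (h l)) (v l) < - \<sigma>" using v(2)[OF l(1)] by (simp add: P_def)
    have "\<exists>\<theta>. 0 < \<theta> \<and> \<theta> < t n \<and>
        - \<sigma> \<le> blinfun_apply (I' (h (x (q n)) + \<theta> *\<^sub>R v (x (q n)))) (v (x (q n)))" for n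
    proof -
      let ?u = "x (q n)"
      obtain \<theta> where \<theta>: "0 < \<theta>" "\<theta> < t n"
        "I (h ?u + t n *\<^sub>R v ?u) - I (h ?u) = t n * blinfun_apply (I' (h ?u + \<theta> *\<^sub>R v ?u)) (v ?u)"
        using mean_value_along_segment[where I = I and I' = I', OF deriv t0] by metis
      have "- \<sigma> * t n \<le> I (h ?u + t n *\<^sub>R v ?u) - I (h ?u)"
        using x(2)[of "q n"] le[OF x(1)[of "q n"]] by (simp add: t_def)
      then have "t n * (- \<sigma>) \<le> t n * blinfun_apply (I' (h ?u + \<theta> *\<^sub>R v ?u)) (v ?u)"
        unfolding \<theta>(3) by (simp add: mult.commute)
      then have "- \<sigma> \<le> blinfun_apply (I' (h ?u + \<theta> *\<^sub>R v ?u)) (v ?u)"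
        using t0[of n] by (metis mult_le_cancel_left_pos)
      then show ?thesis using \<theta> by blast
    qed
    then obtain \<theta> where \<theta>: "\<And>n. 0 < \<theta> n" "\<And>n. \<theta> n < t n"
        "\<And>n. - \<sigma> \<le> blinfun_apply (I' (h (x (q n)) + \<theta> n *\<^sub>R v (x (q n)))) (v (x (q n)))"
      by metis
    have "\<theta> \<longlonglongrightarrow> 0"
      by (rule tendsto_sandwich[OF _ _ tendsto_const tlim]) (intro always_eventually allI less_imp_le \<theta>)+
    then have "(\<lambda>n. I' (h (x (q n)) + \<theta> n *\<^sub>R v (x (q n)))) \<longlonglongrightarrow> I' (h l)"
      by (intro continuous_on_tendsto_compose[OF cI' shift]) auto
    then have "(\<lambda>n. blinfun_apply (I' (h (x (q n)) + \<theta> n *\<^sub>R v (x (q n)))) (v (x (q n))))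
        \<longlonglongrightarrow> blinfun_apply (I' (h l)) (v l)"
      by (intro tendsto_intros vlim)
    then have "- \<sigma> \<le> blinfun_apply (I' (h l)) (v l)"
      by (rule LIMSEQ_le_const) (use \<theta>(3) in auto)
    then show False using neg by simp
  qed
  then obtain t where "t > 0" "\<forall>u\<in>M. I (h u + t *\<^sub>R v u) < s - \<sigma> * t" by blast
  with v show thesis by (intro that[of t v]) (auto simp: P_def)
qed

text \<open>The general minimax principle, without a deformation flow: Ekeland's principle is applied to
  \<open>h \<mapsto> max I \<circ> h\<close> on the complete metric space of continuous maps on \<open>M\<close> that agree with \<open>g\<close> on
  \<open>K\<close>. Were \<open>I'\<close> larger than \<open>\<sigma>\<close> at all maximum points of the resulting \<open>h\<close>, then
  \<open>descent_perturbation\<close> would lower the maximum faster than Ekeland's principle permits.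
  Agreement with \<open>g\<close> on \<open>K\<close> forces the maximum point \<open>u\<close> out of \<open>K\<close>: so \<open>w = h u\<close> is close to a
  value of \<open>g\<close> taken outside \<open>K\<close>, which is how extra information on \<open>g\<close> there is passed on to \<open>w\<close>.\<close>

theorem near_critical_point:
  fixes I :: "'a::banach \<Rightarrow> real" and g :: "'b::metric_space \<Rightarrow> 'a"
  assumes deriv: "\<And>u. (I has_derivative blinfun_apply (I' u)) (at u)"
    and cI': "continuous_on UNIV I'"
    and cM: "compact M" and K: "closed K" and cg: "continuous_on M g" and \<sigma>: "\<sigma> > 0"
    and upper: "\<And>u. u \<in> M \<Longrightarrow> I (g u) \<le> c + \<sigma>\<^sup>2"
    and ltK: "\<And>u. u \<in> M \<inter> K \<Longrightarrow> I (g u) < c"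
    and link: "\<And>h. \<lbrakk>continuous_on M h; \<And>u. u \<in> M \<inter> K \<Longrightarrow> h u = g u\<rbrakk> \<Longrightarrow> \<exists>u\<in>M. c \<le> I (h u)"
  obtains u w where "u \<in> M" "u \<notin> K" "dist (g u) w \<le> \<sigma>"
    "c \<le> I w" "I w \<le> c + \<sigma>\<^sup>2" "norm (I' w) \<le> \<sigma>"
proof -
  have cI: "continuous_on UNIV I"
    using deriv by (meson continuous_at_imp_continuous_on has_derivative_continuous)
  have neM: "M \<noteq> {}" using link[OF cg] by auto
  define \<phi> where "\<phi> = (\<lambda>h. SUP u\<in>M. I (h u))"
  have cIh: "continuous_on M (\<lambda>u. I (h u))" if "continuous_on M h" for h
    by (rule continuous_on_compose2[OF cI that]) auto
  have ub: "I (h u) \<le> \<phi> h" if "continuous_on M h" "u \<in> M" for h u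
    unfolding \<phi>_def
    by (rule cSUP_upper[OF that(2)])
      (intro bounded_imp_bdd_above compact_imp_bounded compact_continuous_image cM cIh that)
  have attained: "\<exists>u\<in>M. I (h u) = \<phi> h" if ch: "continuous_on M h" for h
  proof -
    obtain u where u: "u \<in> M" "\<And>x. x \<in> M \<Longrightarrow> I (h x) \<le> I (h u)"
      using continuous_attains_sup[OF cM neM cIh[OF ch]] by blast
    have "\<phi> h \<le> I (h u)" unfolding \<phi>_def by (rule cSUP_least[OF neM u(2)])
    then show ?thesis using ub[OF ch u(1)] u(1) by force
  qed
  define \<F> :: "('b \<Rightarrow> 'a) metric" where "\<F> = cfunspace (top_of_set M) euclidean_metric"
  interpret F: Metric_space "mspace \<F>" "mdist \<F>" by (rule Metric_space_mspace_mdist)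
  have mspace_F: "h \<in> mspace \<F> \<longleftrightarrow> h \<in> extensional M \<and> continuous_on M h" for h
    using cM by (simp add: \<F>_def compactin_mspace_cfunspace compactin_subtopology del: mspace_cfunspace)
  have complete: "F.mcomplete"
    using Met_TC.mcomplete_cfunspace[of "top_of_set M"] complete_UNIV
    by (simp add: \<F>_def mcomplete_of_def euclidean_metric_def Met_TC.Self_def)
  have dist_le: "dist (f u) (h u) \<le> mdist \<F> f h"
    if "f \<in> mspace \<F>" "h \<in> mspace \<F>" "u \<in> M" for f h u
    using mdist_cfunspace_imp_mdist_le[of f "top_of_set M" euclidean_metric h "mdist \<F> f h" u] that
    by (simp add: \<F>_def del: mspace_cfunspace)
  \<comment> \<open>Members of the function space are extensional, hence the restriction of \<open>g\<close> below.\<close>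
  define C where "C = {h \<in> mspace \<F>. \<forall>u\<in>M \<inter> K. h u = g u}"
  have C_cont: "continuous_on M h" if "h \<in> C" for h using that by (simp add: C_def mspace_F)
  have C_lower: "c \<le> \<phi> h" if "h \<in> C" for h
  proof -
    have "\<exists>u\<in>M. c \<le> I (h u)" using that by (intro link) (auto simp: C_def mspace_F)
    then show ?thesis using ub[OF C_cont[OF that]] by force
  qed
  have gC: "restrict g M \<in> C"
    using cg by (auto simp: C_def mspace_F cong: continuous_on_cong)
  have lsc: "x \<in> C \<and> \<phi> x \<le> a"
    if s: "range s \<subseteq> C" and lim: "limitin F.mtopology s x sequentially"
      and le: "\<forall>\<^sub>F n in sequentially. \<phi> (s n) \<le> a" for s x a
  proof -
    have sC: "s n \<in> C" for n using s by auto
    have xF: "x \<in> mspace \<F>" using lim F.limitin_mspace by blast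
    have dlim: "(\<lambda>n. mdist \<F> (s n) x) \<longlonglongrightarrow> 0"
    proof (rule tendstoI)
      fix e :: real assume "e > 0"
      then have "\<forall>\<^sub>F n in sequentially. s n \<in> mspace \<F> \<and> mdist \<F> (s n) x < e"
        using lim by (simp add: F.limitin_metric)
      then show "\<forall>\<^sub>F n in sequentially. dist (mdist \<F> (s n) x) 0 < e"
        by eventually_elim (simp add: F.nonneg)
    qed
    have pointwise: "(\<lambda>n. s n u) \<longlonglongrightarrow> x u" if "u \<in> M" for u
    proof (rule metric_tendsto_imp_tendsto[OF dlim])
      show "\<forall>\<^sub>F n in sequentially. dist (s n u) (x u) \<le> dist (mdist \<F> (s n) x) 0"
        using dist_le[OF _ xF that] sC by (auto simp: C_def F.nonneg)
    qed
    have "x u = g u" if "u \<in> M \<inter> K" for u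
    proof (rule LIMSEQ_unique)
      show "(\<lambda>n. s n u) \<longlonglongrightarrow> x u" using that pointwise by blast
      show "(\<lambda>n. s n u) \<longlonglongrightarrow> g u" using sC that by (simp add: C_def)
    qed
    then have xC: "x \<in> C" using xF by (simp add: C_def)
    obtain u where u: "u \<in> M" "I (x u) = \<phi> x" using attained[OF C_cont[OF xC]] by blast
    have "(\<lambda>n. I (s n u)) \<longlonglongrightarrow> I (x u)"
      by (rule continuous_on_tendsto_compose[OF cI pointwise[OF u(1)]]) auto
    moreover have "\<forall>\<^sub>F n in sequentially. I (s n u) \<le> a"
      using le by eventually_elim (use ub[OF C_cont[OF sC] u(1)] order_trans in blast)
    ultimately have "I (x u) \<le> a" by (rule tendsto_upperbound) simp
    then show ?thesis using xC u by simp
  qed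
  obtain h where h: "h \<in> C" "\<phi> h + \<sigma> * mdist \<F> (restrict g M) h \<le> \<phi> (restrict g M)"
    and hmin: "\<And>f. f \<in> C \<Longrightarrow> \<phi> h \<le> \<phi> f + \<sigma> * mdist \<F> h f"
    by (rule F.ekeland_variational_principle[OF complete _ gC \<sigma> C_lower lsc])
      (auto simp: C_def)
  have hF: "h \<in> mspace \<F>" and ch: "continuous_on M h" and hK: "\<And>u. u \<in> M \<inter> K \<Longrightarrow> h u = g u"
    using h(1) by (auto simp: C_def mspace_F)
  have "\<phi> (restrict g M) \<le> c + \<sigma>\<^sup>2"
    using attained[OF C_cont[OF gC]] upper by force
  then have \<phi>h: "\<phi> h + \<sigma> * mdist \<F> (restrict g M) h \<le> c + \<sigma>\<^sup>2" using h(2) by linarith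
  have "\<sigma> * mdist \<F> (restrict g M) h \<le> \<sigma> * \<sigma>"
    using \<phi>h C_lower[OF h(1)] by (simp add: power2_eq_square)
  then have near: "mdist \<F> (restrict g M) h \<le> \<sigma>" using \<sigma> by simp
  have "\<exists>u\<in>M. I (h u) = \<phi> h \<and> norm (I' (h u)) \<le> \<sigma>"
  proof (rule ccontr)
    assume "\<not> ?thesis"
    then have steep: "norm (I' (h u)) > \<sigma>" if "u \<in> M" "I (h u) = \<phi> h" for u
      using that by force
    have below: "I (h u) < \<phi> h" if "u \<in> M \<inter> K" for u
      using ltK[OF that] hK[OF that] C_lower[OF h(1)] by simp
    obtain v t where vt: "t > 0" "continuous_on M v" "\<And>u. u \<in> M \<Longrightarrow> norm (v u) \<le> 1"
      "\<And>u. u \<in> M \<inter> K \<Longrightarrow> v u = 0" "\<And>u. u \<in> M \<Longrightarrow> I (h u + t *\<^sub>R v u) < \<phi> h - \<sigma> * t"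
      using descent_perturbation[where I' = I', OF deriv cI' cM K ch ub[OF ch] below steep less_imp_le[OF \<sigma>]]
      by metis
    define f where "f = restrict (\<lambda>u. h u + t *\<^sub>R v u) M"
    have "continuous_on M (\<lambda>u. h u + t *\<^sub>R v u)" by (intro continuous_intros ch vt)
    then have cf: "continuous_on M f" by (simp add: f_def cong: continuous_on_cong)
    have fC: "f \<in> C" using cf hK vt(4) by (auto simp: C_def mspace_F f_def)
    have "mdist \<F> h f \<le> t"
      unfolding \<F>_def
      by (rule mdist_cfunspace_le) (use vt in \<open>auto simp: f_def dist_norm mult_left_le\<close>)
    then have "\<sigma> * mdist \<F> h f \<le> \<sigma> * t" using \<sigma> by simp
    moreover have "\<phi> f < \<phi> h - \<sigma> * t"
      using attained[OF cf] vt(5) by (force simp: f_def)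
    ultimately show False using hmin[OF fC] by linarith
  qed
  then obtain u where u: "u \<in> M" "I (h u) = \<phi> h" "norm (I' (h u)) \<le> \<sigma>" by blast
  show thesis
  proof (rule that[of u "h u"])
    show "u \<notin> K" using ltK[of u] hK[of u] u C_lower[OF h(1)] by force
    show "dist (g u) (h u) \<le> \<sigma>"
      using dist_le[of "restrict g M" h u] gC hF u near by (simp add: C_def)
    show "c \<le> I (h u)" using C_lower[OF h(1)] u by simp
    have "0 \<le> \<sigma> * mdist \<F> (restrict g M) h" using \<sigma> F.nonneg by simp
    then show "I (h u) \<le> c + \<sigma>\<^sup>2" using \<phi>h u by linarith
  qed (use u in auto)
qed

section \<open>The linking geometry\<close>

text \<open>Repairs the boundary values of a map \<open>h\<close> that agrees on \<open>M0\<close> with a map \<open>p\<close> close to the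
  identity. Adding \<open>u - p u\<close> achieves this on \<open>M0\<close>, and the correction is cut off so close to \<open>M0\<close>
  that \<open>h\<close> has hardly moved away from its boundary values there. The new map differs from \<open>h\<close> only
  at points that it sends near \<open>M0\<close>, which is harmless for a functional that is small there.\<close>

lemma boundary_correction:
  fixes h p :: "'a::real_normed_vector \<Rightarrow> 'a"
  assumes cM: "compact M" and M0: "M0 \<subseteq> M" "compact M0" "M0 \<noteq> {}"
    and cp: "continuous_on M p" and ch: "continuous_on M h"
    and agree: "\<And>u. u \<in> M0 \<Longrightarrow> h u = p u"
    and near: "\<And>u. u \<in> M0 \<Longrightarrow> norm (p u - u) < \<eta>" and \<eta>: "\<eta> > 0"
  obtains \<gamma> where "continuous_on M \<gamma>" "\<And>u. u \<in> M0 \<Longrightarrow> \<gamma> u = u"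
    "\<And>u. u \<in> M \<Longrightarrow> \<gamma> u = h u \<or> (\<exists>a\<in>M0. dist (\<gamma> u) a < 4 * \<eta>)"
proof -
  define F where "F = (\<lambda>u. u - p u)"
  have cF: "continuous_on M F" unfolding F_def by (intro continuous_intros cp)
  obtain d1 where d1: "d1 > 0" "\<And>x y. \<lbrakk>x \<in> M; y \<in> M; dist y x < d1\<rbrakk> \<Longrightarrow> dist (h y) (h x) < \<eta>"
    using compact_uniformly_continuous[OF ch cM] \<eta> unfolding uniformly_continuous_on_def by metis
  obtain d2 where d2: "d2 > 0" "\<And>x y. \<lbrakk>x \<in> M; y \<in> M; dist y x < d2\<rbrakk> \<Longrightarrow> dist (F y) (F x) < \<eta>"
    using compact_uniformly_continuous[OF cF cM] \<eta> unfolding uniformly_continuous_on_def by metis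
  define \<delta> where "\<delta> = min d1 d2"
  have \<delta>: "\<delta> > 0" using d1 d2 by (simp add: \<delta>_def)
  define \<theta> where "\<theta> = (\<lambda>u. max 0 (1 - infdist u M0 / \<delta>))"
  define \<gamma> where "\<gamma> = (\<lambda>u. h u + \<theta> u *\<^sub>R F u)"
  have \<theta>: "0 \<le> \<theta> u" "\<theta> u \<le> 1" for u using \<delta> by (auto simp: \<theta>_def infdist_nonneg)
  show thesis
  proof (rule that[of \<gamma>])
    show "continuous_on M \<gamma>"
      unfolding \<gamma>_def \<theta>_def by (intro continuous_intros ch cF) (use \<delta> in auto)
    show "\<gamma> u = u" if "u \<in> M0" for u
      using that agree by (simp add: \<gamma>_def \<theta>_def F_def)
    show "\<gamma> u = h u \<or> (\<exists>a\<in>M0. dist (\<gamma> u) a < 4 * \<eta>)" if u: "u \<in> M" for u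
    proof (cases "\<theta> u = 0")
      case True
      then show ?thesis by (simp add: \<gamma>_def)
    next
      case False
      then have "infdist u M0 / \<delta> < 1" by (auto simp: \<theta>_def max_def less_le split: if_splits)
      then have "infdist u M0 < \<delta>" using \<delta> by (simp add: field_simps)
      then obtain a where a: "a \<in> M0" "dist u a < \<delta>"
        using cINF_less_iff[OF M0(3), of "dist u" \<delta>] M0(3) by (auto simp: infdist_def bdd_below_def intro: zero_le_dist)
      have aM: "a \<in> M" using a M0 by blast
      have 1: "norm (h u - h a) < \<eta>" using d1(2)[OF aM u] a by (simp add: \<delta>_def dist_norm)
      have 2: "norm (F u - F a) < \<eta>" using d2(2)[OF aM u] a by (simp add: \<delta>_def dist_norm)
      have 3: "norm (p a - a) < \<eta>" using near a by blast
      have Fa: "norm (F a) < \<eta>" using 3 by (simp add: F_def norm_minus_commute)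
      have "norm (F u) \<le> norm (F u - F a) + norm (F a)" using norm_triangle_ineq[of "F u - F a" "F a"] by simp
      then have "norm (F u) < 2 * \<eta>" using 2 Fa by linarith
      moreover have "norm (\<theta> u *\<^sub>R F u) \<le> norm (F u)" using \<theta>[of u] by (simp add: mult_left_le_one_le)
      ultimately have 4: "norm (\<theta> u *\<^sub>R F u) < 2 * \<eta>" by linarith
      have "\<gamma> u - a = ((h u - h a) + (p a - a)) + \<theta> u *\<^sub>R F u"
        using agree[OF a(1)] by (simp add: \<gamma>_def)
      then have "norm (\<gamma> u - a) \<le> (norm (h u - h a) + norm (p a - a)) + norm (\<theta> u *\<^sub>R F u)"
        by (metis norm_triangle_le norm_triangle_ineq add_right_mono)
      then have "dist (\<gamma> u) a < 4 * \<eta>" using 1 3 4 by (simp add: dist_norm)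
      then show ?thesis using a by blast
    qed
  qed
qed

lemma direct_sum_projections:
  assumes "topological_direct_sum Y Z"
  obtains P Q where "continuous_on UNIV P" "continuous_on UNIV Q"
    "\<And>u. P u \<in> Y" "\<And>u. Q u \<in> Z" "\<And>u. P u + Q u = u"
    "\<And>y z. \<lbrakk>y \<in> Y; z \<in> Z\<rbrakk> \<Longrightarrow> P (y + z) = y" "\<And>y z. \<lbrakk>y \<in> Y; z \<in> Z\<rbrakk> \<Longrightarrow> Q (y + z) = z"
proof -
  obtain q where q: "homeomorphism (Y \<times> Z) UNIV (\<lambda>(y, z). y + z) q"
    using assms by (auto simp: topological_direct_sum_def)
  have cq: "continuous_on UNIV q" and qim: "range q = Y \<times> Z"
    and inv: "\<And>y z. \<lbrakk>y \<in> Y; z \<in> Z\<rbrakk> \<Longrightarrow> q (y + z) = (y, z)"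
    and qi: "\<And>u. (case q u of (y, z) \<Rightarrow> y + z) = u"
    using q by (auto simp: homeomorphism_def)
  have mem: "q u \<in> Y \<times> Z" for u using qim by blast
  show thesis
  proof (rule that[of "fst \<circ> q" "snd \<circ> q"])
    show "continuous_on UNIV (fst \<circ> q)" "continuous_on UNIV (snd \<circ> q)"
      unfolding o_def by (intro continuous_intros cq)+
  qed (use mem qi inv in \<open>auto simp: mem_Times_iff case_prod_unfold\<close>)
qed

locale linking_geometry =
  fixes Y Z :: "'a::banach set" and z :: 'a and r \<rho> :: real
  assumes sum: "topological_direct_sum Y Z" and fin: "finite_dimensional Y"
    and radii: "\<rho> > r" "r > 0" and z: "z \<in> Z" "norm z = r"
begin

lemma subspaces: "subspace Y" "subspace Z"
  using sum by (auto simp: topological_direct_sum_def)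

lemma M0_subset_M: "link_M0 Y z \<rho> \<subseteq> link_M Y z \<rho>"
proof
  fix u assume "u \<in> link_M0 Y z \<rho>"
  then consider "u \<in> Y" "norm u \<le> \<rho>" | y t where "y \<in> Y" "t > 0" "u = y + t *\<^sub>R z" "norm u = \<rho>"
    by (auto simp: link_M0_def)
  then show "u \<in> link_M Y z \<rho>"
  proof cases
    case 1
    then have "u = u + 0 *\<^sub>R z" by simp
    then show ?thesis using 1 unfolding link_M_def by blast
  next
    case 2
    then show ?thesis unfolding link_M_def by (auto intro: less_imp_le)
  qed
qed

lemma zero_in_M0: "0 \<in> link_M0 Y z \<rho>"
  using subspaces radii by (auto simp: link_M0_def subspace_0)

text \<open>
  With \<open>u = y + t z\<close>, the set \<open>W\<close> consists of the points with \<open>t \<le> 0\<close> or \<open>norm u \<ge> \<rho>\<close>. As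
  \<open>norm (Q u) / r = \<bar>t\<bar>\<close>, the sign of \<open>t\<close> can be expressed by equations between continuous
  functions of \<open>u\<close>, which shows at once that all these sets are closed.\<close>

lemma link_decomposition:
  obtains P Q W where "continuous_on UNIV P" "continuous_on UNIV Q"
    "\<And>u. P u \<in> Y" "\<And>u. Q u \<in> Z" "\<And>u. P u + Q u = u"
    "\<And>y z. \<lbrakk>y \<in> Y; z \<in> Z\<rbrakk> \<Longrightarrow> P (y + z) = y" "\<And>y z. \<lbrakk>y \<in> Y; z \<in> Z\<rbrakk> \<Longrightarrow> Q (y + z) = z"
    "closed (link_M Y z \<rho>)" "closed W"
    "link_M Y z \<rho> \<union> W = {y + t *\<^sub>R z |y t. y \<in> Y}" "link_M Y z \<rho> \<inter> W = link_M0 Y z \<rho>"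
proof -
  obtain P Q where PQ: "continuous_on UNIV P" "continuous_on UNIV Q"
    "\<And>u. P u \<in> Y" "\<And>u. Q u \<in> Z" "\<And>u. P u + Q u = u"
    "\<And>y z. \<lbrakk>y \<in> Y; z \<in> Z\<rbrakk> \<Longrightarrow> P (y + z) = y" "\<And>y z. \<lbrakk>y \<in> Y; z \<in> Z\<rbrakk> \<Longrightarrow> Q (y + z) = z"
    by (rule direct_sum_projections[OF sum]) (rule that)
  have z0: "z \<noteq> 0" using z radii by auto
  have tz: "t *\<^sub>R z \<in> Z" for t using z subspaces by (simp add: subspace_scale)
  have Qz: "Q (y + t *\<^sub>R z) = t *\<^sub>R z" if "y \<in> Y" for y t using PQ(7)[OF that tz] .
  define \<tau> where "\<tau> = (\<lambda>u. norm (Q u) / r)"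
  have \<tau>: "\<tau> (y + t *\<^sub>R z) = \<bar>t\<bar>" if "y \<in> Y" for y t
    using that radii z by (simp add: \<tau>_def Qz)
  have \<tau>0: "\<tau> u \<ge> 0" for u using radii by (simp add: \<tau>_def)
  have c\<tau>: "continuous_on UNIV \<tau>" unfolding \<tau>_def by (intro continuous_intros PQ) (use radii in auto)
  have recompose: "u = P u + s *\<^sub>R z" if "Q u = s *\<^sub>R z" for u s using PQ(5)[of u] that by simp
  have M: "link_M Y z \<rho> = {u. Q u = \<tau> u *\<^sub>R z} \<inter> {u. norm u \<le> \<rho>}"
  proof safe
    fix u assume u: "Q u = \<tau> u *\<^sub>R z" "norm u \<le> \<rho>"
    show "u \<in> link_M Y z \<rho>"
      unfolding link_M_def using recompose[OF u(1)] u(2) PQ(3) \<tau>0 by blast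
  qed (auto simp: link_M_def Qz \<tau>)
  \<comment> \<open>the points with \<open>t \<le> 0\<close>, and those with \<open>t \<ge> 0\<close> and \<open>norm u \<ge> \<rho>\<close>\<close>
  define W where "W = {u. Q u = (- \<tau> u) *\<^sub>R z} \<union> ({u. Q u = \<tau> u *\<^sub>R z} \<inter> {u. \<rho> \<le> norm u})"
  have cl: "closed {u. Q u = \<tau> u *\<^sub>R z}" "closed {u. Q u = (- \<tau> u) *\<^sub>R z}"
    by (intro closed_Collect_eq continuous_intros PQ c\<tau>)+
  have cn: "closed {u::'a. norm u \<le> \<rho>}" "closed {u::'a. \<rho> \<le> norm u}"
    by (intro closed_Collect_le continuous_intros)+
  show thesis
  proof (rule that[OF PQ])
    show "closed (link_M Y z \<rho>)" unfolding M by (intro closed_Int cl cn)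
    show "closed W" unfolding W_def by (intro closed_Int closed_Un cl cn)
    show "link_M Y z \<rho> \<union> W = {y + t *\<^sub>R z |y t. y \<in> Y}"
    proof (intro equalityI subsetI)
      fix u assume "u \<in> link_M Y z \<rho> \<union> W"
      then have "\<exists>s. Q u = s *\<^sub>R z" unfolding M W_def by blast
      then show "u \<in> {y + t *\<^sub>R z |y t. y \<in> Y}" using recompose PQ(3) by blast
    next
      fix u assume "u \<in> {y + t *\<^sub>R z |y t. y \<in> Y}"
      then obtain y t where u: "y \<in> Y" "u = y + t *\<^sub>R z" by blast
      then have "Q u = t *\<^sub>R z" "\<tau> u = \<bar>t\<bar>" using Qz \<tau> by auto
      then show "u \<in> link_M Y z \<rho> \<union> W"
        unfolding M W_def by (cases "t \<ge> 0") auto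
    qed
    show "link_M Y z \<rho> \<inter> W = link_M0 Y z \<rho>"
    proof (intro equalityI subsetI)
      fix u assume u: "u \<in> link_M Y z \<rho> \<inter> W"
      then have Qu: "Q u = \<tau> u *\<^sub>R z" and nu: "norm u \<le> \<rho>" by (auto simp: M)
      have uP: "u = P u + \<tau> u *\<^sub>R z" using recompose[OF Qu] .
      show "u \<in> link_M0 Y z \<rho>"
      proof (cases "\<tau> u = 0")
        case True
        then have "u \<in> Y" using uP PQ(3)[of u] by simp
        then show ?thesis using nu by (simp add: link_M0_def)
      next
        case False
        then have "Q u \<noteq> (- \<tau> u) *\<^sub>R z" using Qu z0 by (simp add: eq_neg_iff_add_eq_0 flip: scaleR_left_distrib)
        then have "norm u = \<rho>" using u nu by (auto simp: W_def)
        moreover have "\<tau> u > 0" using \<tau>0 False by (simp add: less_le)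
        ultimately show ?thesis using uP PQ(3) unfolding link_M0_def by blast
      qed
    next
      fix u assume u: "u \<in> link_M0 Y z \<rho>"
      have "u \<in> W"
        using u Qz[of u 0] \<tau>[of u 0] by (auto simp: link_M0_def W_def Qz \<tau>)
      then show "u \<in> link_M Y z \<rho> \<inter> W" using u M0_subset_M by blast
    qed
  qed
qed

lemma finite_dimensional_link: "finite_dimensional {y + t *\<^sub>R z |y t. y \<in> Y}"
proof -
  obtain E where E: "finite E" "span E = Y" using fin by (auto simp: finite_dimensional_def)
  have "span (insert z E) = {y + t *\<^sub>R z |y t. y \<in> Y}"
  proof (intro equalityI subsetI)
    fix u assume "u \<in> span (insert z E)"
    then obtain k where "u - k *\<^sub>R z \<in> Y" using E by (auto simp: span_breakdown_eq)
    then have "u = (u - k *\<^sub>R z) + k *\<^sub>R z \<and> u - k *\<^sub>R z \<in> Y" by simp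
    then show "u \<in> {y + t *\<^sub>R z |y t. y \<in> Y}" by blast
  next
    fix u assume "u \<in> {y + t *\<^sub>R z |y t. y \<in> Y}"
    then obtain y t where "y \<in> Y" "u = y + t *\<^sub>R z" by blast
    then have "u - t *\<^sub>R z \<in> span E" using E by simp
    then show "u \<in> span (insert z E)" unfolding span_breakdown_eq by blast
  qed
  then show ?thesis unfolding finite_dimensional_def using E(1) by (metis finite_insert)
qed

lemma compact_M: "compact (link_M Y z \<rho>)" and compact_M0: "compact (link_M0 Y z \<rho>)"
proof -
  obtain W where W: "closed (link_M Y z \<rho>)" "closed W"
    "link_M Y z \<rho> \<union> W = {y + t *\<^sub>R z |y t. y \<in> Y}" "link_M Y z \<rho> \<inter> W = link_M0 Y z \<rho>"
    by (rule link_decomposition) (rule that)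
  have "bounded (link_M Y z \<rho>)" by (auto simp: bounded_iff link_M_def)
  then show M: "compact (link_M Y z \<rho>)"
    using finite_dimensional_compact[OF finite_dimensional_link] W by blast
  show "compact (link_M0 Y z \<rho>)"
    using compact_Int_closed[OF M W(2)] W(4) by simp
qed

text \<open>The map \<open>H u = P (\<gamma> u) + (norm (Q (\<gamma> u)) / r) z\<close> folds \<open>\<gamma>\<close> back into the finite-dimensional space
  \<open>Y + \<real> z\<close> and is the identity where \<open>\<gamma>\<close> is. Hence it covers \<open>z\<close>, and \<open>H u = z\<close> says
  exactly that \<open>P (\<gamma> u) = 0\<close> and \<open>norm (Q (\<gamma> u)) = r\<close>.\<close>

lemma linking_intersection:
  assumes "\<gamma> \<in> link_Gamma Y z \<rho>"
  obtains u where "u \<in> link_M Y z \<rho>" "\<gamma> u \<in> Z" "norm (\<gamma> u) = r"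
proof -
  let ?M = "link_M Y z \<rho>" and ?V = "{y + t *\<^sub>R z |y t. y \<in> Y}"
  obtain P Q W where PQ: "continuous_on UNIV P" "continuous_on UNIV Q"
    "\<And>u. P u \<in> Y" "\<And>u. Q u \<in> Z" "\<And>u. P u + Q u = u"
    "\<And>y z. \<lbrakk>y \<in> Y; z \<in> Z\<rbrakk> \<Longrightarrow> P (y + z) = y" "\<And>y z. \<lbrakk>y \<in> Y; z \<in> Z\<rbrakk> \<Longrightarrow> Q (y + z) = z"
    and W: "closed ?M" "closed W" "?M \<union> W = ?V" "?M \<inter> W = link_M0 Y z \<rho>"
    by (rule link_decomposition) (rule that)
  have c\<gamma>: "continuous_on ?M \<gamma>" and \<gamma>id: "\<And>u. u \<in> link_M0 Y z \<rho> \<Longrightarrow> \<gamma> u = u"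
    using assms by (auto simp: link_Gamma_def)
  have z0: "z \<noteq> 0" using z radii by auto
  have tz: "t *\<^sub>R z \<in> Z" for t using z subspaces by (simp add: subspace_scale)
  define H where "H = (\<lambda>u. P (\<gamma> u) + (norm (Q (\<gamma> u)) / r) *\<^sub>R z)"
  have zM: "z \<in> ?M"
  proof -
    have "z = 0 + 1 *\<^sub>R z" "0 \<in> Y" using subspaces by (auto simp: subspace_0)
    then show ?thesis unfolding link_M_def using z radii
      by (metis (mono_tags, lifting) less_imp_le mem_Collect_eq zero_le_one)
  qed
  have "z \<in> H ` ?M"
  proof (rule identity_on_frontier_covers[OF finite_dimensional_link _ z0 W(1-3)])
    show "z \<in> ?V" using zM W(3) by blast
    show "bounded ?M" using compact_M compact_imp_bounded by blast
    show "continuous_on ?M H"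
      unfolding H_def
      by (intro continuous_intros continuous_on_compose2[OF PQ(1) c\<gamma>]
          continuous_on_compose2[OF PQ(2) c\<gamma>]) (use radii in auto)
    show "H ` ?M \<subseteq> ?V" using PQ(3) by (auto simp: H_def)
    show "H u = u" if uMW: "u \<in> ?M \<inter> W" for u
    proof -
      have u0: "u \<in> link_M0 Y z \<rho>" using uMW W(4) by blast
      obtain y t where yt: "y \<in> Y" "t \<ge> 0" "u = y + t *\<^sub>R z"
        using uMW by (auto simp: link_M_def)
      have "P u = y" "Q u = t *\<^sub>R z" using PQ(6,7)[OF yt(1) tz] yt(3) by auto
      then show ?thesis using \<gamma>id[OF u0] yt z radii by (simp add: H_def)
    qed
  qed (rule zM)
  then obtain u where u: "u \<in> ?M" "H u = z" by blast
  have "0 \<in> Y" using subspaces by (simp add: subspace_0)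
  have "P (\<gamma> u) = P z" "Q z = (norm (Q (\<gamma> u)) / r) *\<^sub>R z"
    using PQ(6)[OF PQ(3) tz, of "\<gamma> u"] PQ(7)[OF PQ(3) tz, of "\<gamma> u"] u(2) unfolding H_def by metis+
  moreover have "P z = 0" "Q z = z"
    using PQ(6)[OF \<open>0 \<in> Y\<close> z(1)] PQ(7)[OF \<open>0 \<in> Y\<close> z(1)] by auto
  ultimately have P0: "P (\<gamma> u) = 0" and "(norm (Q (\<gamma> u)) / r) *\<^sub>R z = 1 *\<^sub>R z" by auto
  then have "norm (Q (\<gamma> u)) = r" using z0 radii by (subst (asm) scaleR_cancel_right) auto
  moreover have "\<gamma> u = Q (\<gamma> u)" using PQ(5)[of "\<gamma> u"] P0 by simp
  ultimately show thesis using that[OF u(1)] PQ(4)[of "\<gamma> u"] by simp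
qed

text \<open>The level is bounded below by the values of \<open>I\<close> on the sphere in \<open>Z\<close>, which every admissible map
  meets, and above by the maximum of \<open>I\<close> on \<open>M\<close>, as the identity is admissible.\<close>

lemma minimax_level_real:
  assumes cI: "continuous_on UNIV I"
    and linking: "(INF u\<in>{u \<in> Z. norm u = r}. ereal (I u)) > ereal (SUP u\<in>link_M0 Y z \<rho>. I u)"
  obtains c where "ereal c = minimax_level I Y z \<rho>" "(SUP u\<in>link_M0 Y z \<rho>. I u) < c"
    "\<And>\<gamma>. \<gamma> \<in> link_Gamma Y z \<rho> \<Longrightarrow> \<exists>u\<in>link_M Y z \<rho>. c \<le> I (\<gamma> u)"
    "\<And>e. e > 0 \<Longrightarrow> \<exists>\<gamma>\<in>link_Gamma Y z \<rho>. \<forall>u\<in>link_M Y z \<rho>. I (\<gamma> u) \<le> c + e"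
proof -
  let ?M = "link_M Y z \<rho>" and ?bd = "link_M0 Y z \<rho>" and ?\<Gamma> = "link_Gamma Y z \<rho>"
  let ?\<Phi> = "\<lambda>\<gamma>. SUP u\<in>\<gamma> ` ?M. I u"
  have neM: "?M \<noteq> {}" using zero_in_M0 M0_subset_M by blast
  have cI\<gamma>: "continuous_on ?M (\<lambda>u. I (\<gamma> u))" if "\<gamma> \<in> ?\<Gamma>" for \<gamma>
    by (rule continuous_on_compose2[OF cI]) (use that in \<open>auto simp: link_Gamma_def\<close>)
  have upper: "I (\<gamma> u) \<le> ?\<Phi> \<gamma>" if g: "\<gamma> \<in> ?\<Gamma>" and u: "u \<in> ?M" for \<gamma> u
    unfolding image_image
    by (rule cSUP_upper[OF u])
      (intro bounded_imp_bdd_above compact_imp_bounded compact_continuous_image compact_M cI\<gamma> g)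
  have attained: "\<exists>u\<in>?M. ?\<Phi> \<gamma> \<le> I (\<gamma> u)" if g: "\<gamma> \<in> ?\<Gamma>" for \<gamma>
  proof -
    obtain u where u: "u \<in> ?M" "\<And>x. x \<in> ?M \<Longrightarrow> I (\<gamma> x) \<le> I (\<gamma> u)"
      using continuous_attains_sup[OF compact_M neM cI\<gamma>[OF g]] by blast
    have "?\<Phi> \<gamma> \<le> I (\<gamma> u)" unfolding image_image by (rule cSUP_least[OF neM u(2)])
    then show ?thesis using u(1) by blast
  qed
  have "(INF u\<in>{u \<in> Z. norm u = r}. ereal (I u)) \<le> minimax_level I Y z \<rho>"
    unfolding minimax_level_def
  proof (rule INF_greatest)
    fix \<gamma> assume g: "\<gamma> \<in> ?\<Gamma>"
    obtain u where u: "u \<in> ?M" "\<gamma> u \<in> Z" "norm (\<gamma> u) = r" by (rule linking_intersection[OF g])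
    have "(INF u\<in>{u \<in> Z. norm u = r}. ereal (I u)) \<le> ereal (I (\<gamma> u))"
      by (rule INF_lower) (use u in auto)
    also have "\<dots> \<le> ereal (?\<Phi> \<gamma>)" using upper[OF g u(1)] by simp
    finally show "(INF u\<in>{u \<in> Z. norm u = r}. ereal (I u)) \<le> ereal (?\<Phi> \<gamma>)" .
  qed
  then have low: "ereal (SUP u\<in>?bd. I u) < minimax_level I Y z \<rho>" using linking by (rule less_le_trans[rotated])
  have "(\<lambda>u. u) \<in> ?\<Gamma>" by (simp add: link_Gamma_def)
  then have high: "minimax_level I Y z \<rho> \<le> ereal (?\<Phi> (\<lambda>u. u))"
    unfolding minimax_level_def by (rule INF_lower)
  obtain c where c: "ereal c = minimax_level I Y z \<rho>"
    using low high by (cases "minimax_level I Y z \<rho>") auto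
  show thesis
  proof (rule that[OF c])
    show "(SUP u\<in>?bd. I u) < c" using low c by (metis less_ereal.simps(1))
    show "\<exists>u\<in>?M. c \<le> I (\<gamma> u)" if g: "\<gamma> \<in> ?\<Gamma>" for \<gamma>
    proof -
      have "ereal c \<le> ereal (?\<Phi> \<gamma>)"
        unfolding c minimax_level_def using g by (rule INF_lower)
      then have "c \<le> ?\<Phi> \<gamma>" by simp
      then show ?thesis using attained[OF g] order_trans by blast
    qed
    show "\<exists>\<gamma>\<in>?\<Gamma>. \<forall>u\<in>?M. I (\<gamma> u) \<le> c + e" if "e > 0" for e
    proof -
      have "minimax_level I Y z \<rho> < ereal (c + e)" using that by (simp flip: c)
      then obtain \<gamma> where g: "\<gamma> \<in> ?\<Gamma>" "ereal (?\<Phi> \<gamma>) < ereal (c + e)"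
        unfolding minimax_level_def INF_less_iff by blast
      then have "I (\<gamma> u) \<le> c + e" if "u \<in> ?M" for u
        using upper[OF g(1) that] by simp
      then show ?thesis using g(1) by blast
    qed
  qed
qed

end

section \<open>Bounded almost critical sequences\<close>

lemma strict_bound_near_compact:
  fixes I :: "'a::metric_space \<Rightarrow> real"
  assumes "continuous_on UNIV I" "compact C" "\<And>u. u \<in> C \<Longrightarrow> I u < s"
  obtains \<eta> where "\<eta> > 0" "\<And>w a. \<lbrakk>a \<in> C; dist w a < \<eta>\<rbrakk> \<Longrightarrow> I w < s"
proof -
  have "open {w. I w < s}" by (intro open_Collect_less assms continuous_intros)
  moreover have "C \<subseteq> {w. I w < s}" using assms(3) by blast
  ultimately obtain d where "d > 0" "(\<Union>a\<in>C. ball a d) \<subseteq> {w. I w < s}"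
    using compact_subset_open_imp_ball_epsilon_subset[OF assms(2)] by blast
  then show thesis by (intro that[of d]) (auto simp: dist_commute subset_eq)
qed

text \<open>The distance to a sublevel set is at most the distance to one of its points, so condition (A)
  bounds \<open>A\<close> near any point where it is already bounded.\<close>

lemma condition_A_enlarge:
  assumes "condition_A A" "0 < l1" "l1 < l2"
  obtains \<delta> where "\<delta> > 0" "\<And>v w. \<lbrakk>A v \<le> l1; norm (w - v) \<le> \<delta>\<rbrakk> \<Longrightarrow> A w \<le> l2"
proof -
  obtain \<delta> where \<delta>: "\<delta> > 0"
    "\<And>u. set_distance u (sublevel A l1) \<le> ereal \<delta> \<Longrightarrow> u \<in> sublevel A l2"
    using assms unfolding condition_A_def by blast
  have "A w \<le> l2" if "A v \<le> l1" "norm (w - v) \<le> \<delta>" for v w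
  proof -
    have "set_distance w (sublevel A l1) \<le> ereal (norm (w - v))"
      unfolding set_distance_def by (rule INF_lower) (use that in \<open>simp add: sublevel_def\<close>)
    also have "\<dots> \<le> ereal \<delta>" using that by simp
    finally show ?thesis using \<delta>(2) by (simp add: sublevel_def)
  qed
  then show thesis using that \<delta>(1) by blast
qed

lemma frequently_bounded_of_liminf:
  fixes x :: "nat \<Rightarrow> real"
  assumes "liminf (\<lambda>n. ereal (x n)) < \<infinity>"
  obtains L :: real where "L \<ge> 0" "\<exists>\<^sub>F n in sequentially. x n < L"
proof -
  obtain N :: nat where N: "liminf (\<lambda>n. ereal (x n)) < ereal (real N)"
    using assms less_PInf_Ex_of_nat by auto
  have "\<exists>\<^sub>F n in sequentially. x n < real N"
    unfolding frequently_def
  proof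
    assume "\<forall>\<^sub>F n in sequentially. \<not> x n < real N"
    then have "\<forall>\<^sub>F n in sequentially. ereal (real N) \<le> ereal (x n)"
      by eventually_elim simp
    then have "ereal (real N) \<le> liminf (\<lambda>n. ereal (x n))" by (rule Liminf_bounded)
    then show False using N by simp
  qed
  then show thesis using that[of "real N"] by simp
qed

text \<open>This is where a bound on \<open>A\<close> comes from: with \<open>a' = A (\<psi> u)\<close> and \<open>b' = B (\<psi> u)\<close>, lower and upper
  bounds on \<open>I\<close> before and after applying \<open>\<psi>\<close> leave room for only a bounded value of \<open>A (\<psi> u)\<close>.\<close>

lemma Psi_estimate:
  fixes \<alpha> \<beta> a a' b b' :: real
  assumes "\<alpha> * a' \<le> a" "b \<le> \<beta> * b'"
  shows "\<beta> * (a' - b') + (\<alpha> - \<beta>) * a' \<le> a - b"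
  using assms by (simp add: algebra_simps)

theorem theorem2p4:
  fixes I A B :: "'a::banach \<Rightarrow> real"
    and I' :: "'a \<Rightarrow> 'a \<Rightarrow>\<^sub>L real"
    and \<psi> :: "nat \<Rightarrow> 'a \<Rightarrow> 'a"
    and Y Z :: "'a set"
    and z :: 'a
    and r \<rho> :: real
  assumes I_deriv: "\<And>u. (I has_derivative blinfun_apply (I' u)) (at u)"
    and I'_cont: "continuous_on UNIV I'"
    and I_eq: "\<And>u. I u = A u - B u"
    and cond_A: "condition_A A"
    and cond_Psi: "condition_Psi A B \<psi>"
    and sum: "topological_direct_sum Y Z"
    and fin: "finite_dimensional Y"
    and radii: "\<rho> > r" "r > 0"
    and z: "z \<in> Z" "norm z = r"
    and linking: "(INF u\<in>{u \<in> Z. norm u = r}. ereal (I u)) > ereal (SUP u\<in>link_M0 Y z \<rho>. I u)"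
    and psi_lim: "(\<lambda>n. SUP u\<in>link_M0 Y z \<rho>. norm (\<psi> n u - u)) \<longlonglongrightarrow> 0"
  shows "\<exists>c::real. ereal c = minimax_level I Y z \<rho> \<and>
    (\<exists>w :: nat \<Rightarrow> 'a.
       (\<lambda>n. I (w n)) \<longlonglongrightarrow> c \<and>
       (\<lambda>n. I' (w n)) \<longlonglongrightarrow> 0 \<and>
       bdd_above (range (\<lambda>n. A (w n))))"
proof -
  interpret linking_geometry Y Z z r \<rho>
    by unfold_locales (fact sum fin radii z)+
  let ?M = "link_M Y z \<rho>" and ?bd = "link_M0 Y z \<rho>" and ?\<Gamma> = "link_Gamma Y z \<rho>"
  have cI: "continuous_on UNIV I"
    using I_deriv by (meson continuous_at_imp_continuous_on has_derivative_continuous)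
  obtain c where c: "ereal c = minimax_level I Y z \<rho>" and sup_lt: "(SUP u\<in>?bd. I u) < c"
    and c_lower: "\<And>\<gamma>. \<gamma> \<in> ?\<Gamma> \<Longrightarrow> \<exists>u\<in>?M. c \<le> I (\<gamma> u)"
    and c_approx: "\<And>e. e > 0 \<Longrightarrow> \<exists>\<gamma>\<in>?\<Gamma>. \<forall>u\<in>?M. I (\<gamma> u) \<le> c + e"
    by (rule minimax_level_real[OF cI linking]) (rule that)
  define m where "m = (SUP u\<in>?bd. I u)"
  have mc: "m < c" using sup_lt by (simp add: m_def)
  have A0: "0 \<le> A u" for u using cond_A by (simp add: condition_A_def)
  have c\<psi>: "continuous_on S (\<psi> n)" for S n
    using cond_Psi continuous_on_subset unfolding condition_Psi_def by blast
  obtain \<alpha> \<beta> where \<alpha>\<beta>: "\<And>n. \<beta> n < \<alpha> n" "\<And>n. 0 < \<beta> n"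
    and \<Psi>A: "\<And>n u. \<alpha> n * A (\<psi> n u) \<le> A u" and \<Psi>B: "\<And>n u. B u \<le> \<beta> n * B (\<psi> n u)"
    and lim\<alpha>: "\<alpha> \<longlonglongrightarrow> 1" and lim\<beta>: "\<beta> \<longlonglongrightarrow> 1"
    and liminf: "liminf (\<lambda>n. ereal (\<bar>1 - \<beta> n\<bar> / (\<alpha> n - \<beta> n))) < \<infinity>"
    using cond_Psi unfolding condition_Psi_def by blast
  obtain L where L: "L \<ge> 0" "\<exists>\<^sub>F n in sequentially. \<bar>1 - \<beta> n\<bar> / (\<alpha> n - \<beta> n) < L"
    by (rule frequently_bounded_of_liminf[OF liminf])
  \<comment> \<open>the bound on \<open>A\<close> along \<open>\<psi> n \<circ> \<gamma>\<close> that the estimate at the end of \<open>key\<close> produces\<close>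
  define C where "C = L * \<bar>c\<bar> + 3"
  have "C > 0" using L(1) by (simp add: C_def add_nonneg_pos)
  then obtain \<delta> where \<delta>: "\<delta> > 0" "\<And>v w. \<lbrakk>A v \<le> C; norm (w - v) \<le> \<delta>\<rbrakk> \<Longrightarrow> A w \<le> C + 1"
    by (rule condition_A_enlarge[OF cond_A, of C "C + 1"]) auto
  \<comment> \<open>a level strictly between the boundary values and \<open>c\<close>\<close>
  define s where "s = (m + c) / 2"
  have bdd_I: "bdd_above (I ` ?bd)"
    by (intro bounded_imp_bdd_above compact_imp_bounded compact_continuous_image compact_M0
        continuous_on_subset[OF cI]) simp
  have "I u < s" if "u \<in> ?bd" for u
    using cSUP_upper[OF that bdd_I] mc by (simp add: s_def m_def)
  then obtain \<eta>0 where \<eta>0: "\<eta>0 > 0" "\<And>w a. \<lbrakk>a \<in> ?bd; dist w a < \<eta>0\<rbrakk> \<Longrightarrow> I w < s"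
    using strict_bound_near_compact[OF cI compact_M0] by blast
  \<comment> \<open>\<open>boundary_correction\<close> loses a factor 4.\<close>
  define \<eta> where "\<eta> = \<eta>0 / 4"
  have \<eta>: "\<eta> > 0" using \<eta>0 by (simp add: \<eta>_def)
  have key: "\<exists>w. \<bar>I w - c\<bar> \<le> e \<and> norm (I' w) \<le> e \<and> A w \<le> C + 1" if e: "e > 0" for e
  proof -
    define \<sigma> where "\<sigma> = min (min e \<delta>) 1"
    have \<sigma>: "\<sigma> > 0" "\<sigma> \<le> e" "\<sigma> \<le> \<delta>" "\<sigma> \<le> 1" using e \<delta>(1) by (auto simp: \<sigma>_def)
    have \<sigma>2: "\<sigma>\<^sup>2 \<le> e" using \<sigma> by (smt (verit) power2_eq_square mult_left_le)
    have lim\<epsilon>: "(\<lambda>n. \<alpha> n - \<beta> n) \<longlonglongrightarrow> 0" using tendsto_diff[OF lim\<alpha> lim\<beta>] by simp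
    have "(\<lambda>n. (c + (\<alpha> n - \<beta> n)) / \<beta> n) \<longlonglongrightarrow> (c + 0) / 1"
      by (intro tendsto_intros lim\<epsilon> lim\<beta>) simp
    then have "\<forall>\<^sub>F n in sequentially. (c + (\<alpha> n - \<beta> n)) / \<beta> n < c + \<sigma>\<^sup>2"
      using \<sigma>(1) by (intro order_tendstoD(2)) auto
    moreover have "\<forall>\<^sub>F n in sequentially. \<alpha> n - \<beta> n < (c - m) / 2"
      using mc by (intro order_tendstoD(2)[OF lim\<epsilon>]) simp
    moreover have "\<forall>\<^sub>F n in sequentially. \<beta> n < 2"
      by (intro order_tendstoD(2)[OF lim\<beta>]) simp
    moreover have "\<forall>\<^sub>F n in sequentially. (SUP u\<in>?bd. norm (\<psi> n u - u)) < \<eta>"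
      by (rule order_tendstoD(2)[OF psi_lim \<eta>])
    ultimately have ev: "\<forall>\<^sub>F n in sequentially. (c + (\<alpha> n - \<beta> n)) / \<beta> n < c + \<sigma>\<^sup>2 \<and>
        \<alpha> n - \<beta> n < (c - m) / 2 \<and> \<beta> n < 2 \<and> (SUP u\<in>?bd. norm (\<psi> n u - u)) < \<eta>"
      by eventually_elim simp
    obtain n where n: "(c + (\<alpha> n - \<beta> n)) / \<beta> n < c + \<sigma>\<^sup>2" "\<alpha> n - \<beta> n < (c - m) / 2" "\<beta> n < 2"
        "(SUP u\<in>?bd. norm (\<psi> n u - u)) < \<eta>" "\<bar>1 - \<beta> n\<bar> / (\<alpha> n - \<beta> n) < L"
      using frequently_ex[OF frequently_eventually_frequently[OF L(2) ev]] by blast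
    \<comment> \<open>With this tolerance, both the error in \<open>c\<close> and \<open>\<bar>1 - \<beta> n\<bar>\<close> are \<open>O (\<alpha> n - \<beta> n)\<close>,
      the factor in front of \<open>A\<close> in the basic estimate.\<close>
    define \<epsilon> where "\<epsilon> = \<alpha> n - \<beta> n"
    have \<epsilon>: "\<epsilon> > 0" using \<alpha>\<beta>(1)[of n] by (simp add: \<epsilon>_def)
    have bdd_\<psi>: "bdd_above ((\<lambda>u. norm (\<psi> n u - u)) ` ?bd)"
      by (intro bounded_imp_bdd_above compact_imp_bounded compact_continuous_image compact_M0
          continuous_intros c\<psi>)
    have \<psi>near: "norm (\<psi> n u - u) < \<eta>" if "u \<in> ?bd" for u
      using cSUP_upper[OF that bdd_\<psi>] n(4) by simp
    obtain \<gamma> where \<gamma>: "\<gamma> \<in> ?\<Gamma>" "\<And>u. u \<in> ?M \<Longrightarrow> I (\<gamma> u) \<le> c + \<epsilon>"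
      using c_approx[OF \<epsilon>] by blast
    have c\<gamma>: "continuous_on ?M \<gamma>" and \<gamma>id: "\<And>u. u \<in> ?bd \<Longrightarrow> \<gamma> u = u"
      using \<gamma>(1) by (auto simp: link_Gamma_def)
    define g where "g = (\<lambda>u. \<psi> n (\<gamma> u))"
    have cg: "continuous_on ?M g"
      unfolding g_def by (rule continuous_on_compose2[OF c\<psi>[of UNIV] c\<gamma>]) simp
    have est: "\<beta> n * I (g u) + \<epsilon> * A (g u) \<le> c + \<epsilon>" if u: "u \<in> ?M" for u
      using Psi_estimate[OF \<Psi>A[of n "\<gamma> u"] \<Psi>B[of "\<gamma> u" n]] \<gamma>(2)[OF u] by (simp add: g_def \<epsilon>_def I_eq)
    \<comment> \<open>Outside \<open>K\<close> the estimate bounds \<open>A (g u)\<close>, so competitors may differ from \<open>g\<close> only there.\<close>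
    define K where "K = {u \<in> ?M. I (g u) \<le> c - \<epsilon>}"
    have cIg: "continuous_on ?M (\<lambda>u. I (g u))" by (rule continuous_on_compose2[OF cI cg]) simp
    have clK: "closed K"
    proof -
      have "closed (?M \<inter> (\<lambda>u. I (g u)) -` {..c - \<epsilon>})"
        by (rule continuous_closed_preimage[OF cIg compact_imp_closed[OF compact_M]]) simp
      moreover have "K = ?M \<inter> (\<lambda>u. I (g u)) -` {..c - \<epsilon>}" by (auto simp: K_def)
      ultimately show ?thesis by simp
    qed
    have M0K: "u \<in> K" if u: "u \<in> ?bd" for u
    proof -
      have "dist (\<psi> n u) u < \<eta>0" using \<psi>near[OF u] \<eta> by (simp add: \<eta>_def dist_norm)
      then have "I (\<psi> n u) < s" by (rule \<eta>0(2)[OF u])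
      then show ?thesis
        using u M0_subset_M n(2) \<gamma>id[OF u] by (auto simp: K_def g_def s_def \<epsilon>_def)
    qed
    obtain u w where u: "u \<in> ?M" "u \<notin> K" and w: "dist (g u) w \<le> \<sigma>"
      "c \<le> I w" "I w \<le> c + \<sigma>\<^sup>2" "norm (I' w) \<le> \<sigma>"
    proof (rule near_critical_point[where I = I and I' = I', OF I_deriv I'_cont compact_M clK cg \<sigma>(1)])
      show "I (g u) \<le> c + \<sigma>\<^sup>2" if "u \<in> ?M" for u
      proof -
        have "I (g u) * \<beta> n \<le> c + \<epsilon>"
          using est[OF that] mult_nonneg_nonneg[OF less_imp_le[OF \<epsilon>] A0[of "g u"]] by (simp add: mult.commute)
        then have "I (g u) \<le> (c + \<epsilon>) / \<beta> n" using \<alpha>\<beta>(2)[of n] by (simp add: pos_le_divide_eq)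
        then show ?thesis using n(1) by (simp add: \<epsilon>_def)
      qed
      show "I (g u) < c" if "u \<in> ?M \<inter> K" for u using that \<epsilon> by (auto simp: K_def)
      \<comment> \<open>Competitors satisfy \<open>max I \<circ> h \<ge> c\<close>, since repairing their boundary values makes them
        admissible and only creates values of \<open>I\<close> below \<open>c\<close>.\<close>
      fix h assume ch: "continuous_on ?M h" and hg: "\<And>u. u \<in> ?M \<inter> K \<Longrightarrow> h u = g u"
      have h\<psi>: "h u = \<psi> n u" if "u \<in> ?bd" for u
        using hg[of u] M0K[OF that] M0_subset_M that \<gamma>id[OF that] by (auto simp: g_def)
      have "?bd \<noteq> {}" using zero_in_M0 by blast
      obtain f where f: "continuous_on ?M f" "\<And>u. u \<in> ?bd \<Longrightarrow> f u = u"
        "\<And>u. u \<in> ?M \<Longrightarrow> f u = h u \<or> (\<exists>a\<in>?bd. dist (f u) a < 4 * \<eta>)"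
        using boundary_correction[OF compact_M M0_subset_M compact_M0 \<open>?bd \<noteq> {}\<close> c\<psi> ch h\<psi> \<psi>near \<eta>]
        by blast
      have "f \<in> ?\<Gamma>" using f by (simp add: link_Gamma_def)
      then obtain u where u: "u \<in> ?M" "c \<le> I (f u)" using c_lower by blast
      have "\<not> (\<exists>a\<in>?bd. dist (f u) a < 4 * \<eta>)"
        using \<eta>0(2) u(2) mc by (force simp: \<eta>_def s_def)
      then show "\<exists>u\<in>?M. c \<le> I (h u)" using f(3)[OF u(1)] u by metis
    qed (rule that)
    have "c - \<epsilon> < I (g u)" using u by (simp add: K_def)
    then have "\<beta> n * (c - \<epsilon>) \<le> \<beta> n * I (g u)" using \<alpha>\<beta>(2)[of n] by simp
    then have "\<epsilon> * A (g u) \<le> (1 - \<beta> n) * c + \<epsilon> * (1 + \<beta> n)"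
      using est[OF u(1)] by (simp add: algebra_simps)
    also have "(1 - \<beta> n) * c \<le> \<bar>1 - \<beta> n\<bar> * \<bar>c\<bar>" by (metis abs_ge_self abs_mult)
    also have "\<bar>1 - \<beta> n\<bar> * \<bar>c\<bar> \<le> (\<epsilon> * L) * \<bar>c\<bar>"
      using n(5) \<epsilon> by (intro mult_right_mono) (simp_all add: \<epsilon>_def pos_divide_less_eq mult.commute less_imp_le)
    also have "\<epsilon> * (1 + \<beta> n) \<le> \<epsilon> * 3" using n(3) \<epsilon> by simp
    finally have "\<epsilon> * A (g u) \<le> \<epsilon> * C" by (simp add: C_def algebra_simps)
    then have "A (g u) \<le> C" using \<epsilon> by simp
    then have "A w \<le> C + 1"
      using w(1) \<sigma>(3) by (intro \<delta>(2)[of "g u"]) (auto simp: dist_norm norm_minus_commute)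
    then show ?thesis using w \<sigma> \<sigma>2 by (intro exI[of _ w]) auto
  qed
  have "\<forall>n. \<exists>w. \<bar>I w - c\<bar> \<le> inverse (real (Suc n)) \<and> norm (I' w) \<le> inverse (real (Suc n)) \<and> A w \<le> C + 1"
    using key by simp
  then obtain w where w: "\<And>n. \<bar>I (w n) - c\<bar> \<le> inverse (real (Suc n))"
      "\<And>n. norm (I' (w n)) \<le> inverse (real (Suc n))" "\<And>n. A (w n) \<le> C + 1"
    by metis
  have "(\<lambda>n. I (w n) - c) \<longlonglongrightarrow> 0"
    by (rule Lim_null_comparison[OF _ LIMSEQ_inverse_real_of_nat]) (use w(1) in simp)
  then have "(\<lambda>n. I (w n)) \<longlonglongrightarrow> c" by (simp add: LIM_zero_iff)
  moreover have "(\<lambda>n. I' (w n)) \<longlonglongrightarrow> 0"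
    by (rule Lim_null_comparison[OF _ LIMSEQ_inverse_real_of_nat]) (use w(2) in simp)
  moreover have "bdd_above (range (\<lambda>n. A (w n)))" 
    by (intro bdd_aboveI[of _ "C + 1"]) (use w(3) in auto)
  ultimately show ?thesis using c by blast
qed

end
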